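(* Let $A=\bigoplus_{i=1}^mB(X_i)$, $B=\bigoplus_{j=1}^nB(Y_j)$, $H$ a finite-dimensional Hilbert space, $\omega\in B(H)$ invertible with $\mathrm{Tr}(\omega^\dagger\omega)=1$, and $M:A\otimes B(H)\to B$ a channel with minimal dilation $\tau_{ij}:X_i\otimes H\to Y_j\otimes E_{ji}$. Let $\rho_1:=\mathrm{Tr}_{H_2}(W_\omega)\in B(H)$ be the reduced state of $W_\omega$ on the first tensor factor (the one on which $M$ acts). Then $M$ is entanglement-invertible with respect to $W_\omega$ if and only if (a) $M$ is entanglement-invertible with respect to the canonical maximally entangled state $\Phi_H$, and (b) $\rho_1$ is a self-intertwiner of $M$, i.e. there exist operators $g_{ij}\in B(E_{ji})$ with $\tau_{ij}(1_{X_i}\otimes\rho_1)=(1_{Y_j}\otimes g_{ij})\tau_{ij}$ for all $i,j$.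
   Context: All Hilbert spaces are finite-dimensional. A channel is a completely positive trace-preserving linear map (acting on states). $A\otimes B(H)=\bigoplus_iB(X_i\otimes H)$; a channel $M:A\otimes B(H)\to B$ has components $M_{ij}:B(X_i\otimes H)\to B(Y_j)$ with $M(\oplus_i\rho_i)=\oplus_j\sum_iM_{ij}(\rho_i)$. A minimal dilation of $M$ is a family of linear maps $\tau_{ij}:X_i\otimes H\to Y_j\otimes E_{ji}$ with $M_{ij}(\rho)=\mathrm{Tr}_{E_{ji}}(\tau_{ij}\rho\tau_{ij}^\dagger)$ such that, for an orthonormal basis $\{e_k\}$ of $E_{ji}$, the operators $(1\otimes\langle e_k|)\tau_{ij}$ are linearly independent. Fix an orthonormal basis $\{|h\rangle\}$ of $H$; $|\eta_H\rangle=\sum_h|h\rangle\otimes|h\rangle$, $\Phi_H=|\eta_H\rangle\langle\eta_H|/\dim H$; $W_\omega=|w_\omega\rangle\langle w_\omega|$ with $|w_\omega\rangle=\sum_h|h\rangle\otimes\omega|h\rangle\in H\otimes H$ (a pure state). For a state $W$ on $H_1\otimes H_2$ with swap $W'$, a channel $M:A\otimes B(H_1)\to B$ is entanglement-invertible with respect to $W$ if there is a channel $N:B\otimes B(H_2)\to A$ with $N\big((M\otimes\mathrm{id}_{B(H_2)})(\rho\otimes W)\big)=\rho$ for all $\rho\in A$ and $M\big((N\otimes\mathrm{id}_{B(H_1)})(\sigma\otimes W')\big)=\sigma$ for all $\sigma\in B$. Here $H_1=H_2=H$. *)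

theory Defs
  imports "Jordan_Normal_Form.Matrix"
begin

(* Conventions: all Hilbert spaces are C^k with standard basis. The tensor
   product of C^a and C^b is C^(a*b), with basis index (x,y) |-> x*b+y
   (Kronecker ordering). Matrices are complex matrices of the Jordan_Normal_Form
   library. An element of a direct sum of matrix blocks B(C^(d 0)) + ... + B(C^(d (m-1)))
   is a family  R :: nat => complex mat  (only indices < m matter). *)

definition dag :: "complex mat \<Rightarrow> complex mat" where
  "dag A = mat (dim_col A) (dim_row A) (\<lambda>(i,j). cnj (A $$ (j,i)))"

definition mtrace :: "complex mat \<Rightarrow> complex" where
  "mtrace A = (\<Sum>i<dim_row A. A $$ (i,i))"

definition kron :: "complex mat \<Rightarrow> complex mat \<Rightarrow> complex mat" where
  "kron A B = mat (dim_row A * dim_row B) (dim_col A * dim_col B)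
     (\<lambda>(i,j). A $$ (i div dim_row B, j div dim_col B) * B $$ (i mod dim_row B, j mod dim_col B))"

definition psd :: "nat \<Rightarrow> complex mat \<Rightarrow> bool" where
  "psd n A \<longleftrightarrow> A \<in> carrier_mat n n \<and>
     (\<forall>v \<in> carrier_vec n. \<exists>r::real. r \<ge> 0 \<and> (conjugate v) \<bullet> (A *\<^sub>v v) = complex_of_real r)"

definition ptrace2 :: "nat \<Rightarrow> nat \<Rightarrow> complex mat \<Rightarrow> complex mat" where
  "ptrace2 a b R = mat a a (\<lambda>(x,y). \<Sum>k<b. R $$ (x*b+k, y*b+k))"

definition blk :: "nat \<Rightarrow> nat \<Rightarrow> complex mat \<Rightarrow> nat \<Rightarrow> nat \<Rightarrow> complex mat" where
  "blk a k R p q = mat a a (\<lambda>(x,y). R $$ (x*k+p, y*k+q))"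

definition tensor_id ::
  "(complex mat \<Rightarrow> complex mat) \<Rightarrow> nat \<Rightarrow> nat \<Rightarrow> nat \<Rightarrow> complex mat \<Rightarrow> complex mat" where
  "tensor_id Phi a b k R = mat (b*k) (b*k)
     (\<lambda>(r,s). (Phi (blk a k R (r mod k) (s mod k))) $$ (r div k, s div k))"

(* A map between direct sums given by components Phi i j : B(C^(da i)) -> B(C^(db j)),
   Phi(oplus_i R_i) = oplus_j sum_i Phi i j (R_i).  Output block j: *)
definition apply_map ::
  "(nat \<Rightarrow> nat \<Rightarrow> complex mat \<Rightarrow> complex mat) \<Rightarrow> nat \<Rightarrow> (nat \<Rightarrow> nat)
     \<Rightarrow> (nat \<Rightarrow> complex mat) \<Rightarrow> nat \<Rightarrow> complex mat" where
  "apply_map Phi m db R j = mat (db j) (db j) (\<lambda>(r,s). \<Sum>i<m. (Phi i j (R i)) $$ (r,s))"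

definition apply_map_id ::
  "(nat \<Rightarrow> nat \<Rightarrow> complex mat \<Rightarrow> complex mat) \<Rightarrow> (nat \<Rightarrow> nat) \<Rightarrow> nat \<Rightarrow> (nat \<Rightarrow> nat)
     \<Rightarrow> nat \<Rightarrow> (nat \<Rightarrow> complex mat) \<Rightarrow> nat \<Rightarrow> complex mat" where
  "apply_map_id Phi da m db k R j =
     apply_map (\<lambda>i j'. tensor_id (Phi i j') (da i) (db j') k) m (\<lambda>j'. db j' * k) R j"

definition in_sum :: "(nat \<Rightarrow> nat) \<Rightarrow> nat \<Rightarrow> (nat \<Rightarrow> complex mat) \<Rightarrow> bool" where
  "in_sum d m R \<longleftrightarrow> (\<forall>i<m. R i \<in> carrier_mat (d i) (d i))"

definition is_channel ::
  "(nat \<Rightarrow> nat) \<Rightarrow> nat \<Rightarrow> (nat \<Rightarrow> nat) \<Rightarrow> nat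
     \<Rightarrow> (nat \<Rightarrow> nat \<Rightarrow> complex mat \<Rightarrow> complex mat) \<Rightarrow> bool" where
  "is_channel da m db n Phi \<longleftrightarrow>
     (\<forall>i<m. \<forall>j<n. \<forall>A \<in> carrier_mat (da i) (da i). \<forall>B \<in> carrier_mat (da i) (da i). \<forall>c::complex.
        Phi i j A \<in> carrier_mat (db j) (db j) \<and>
        Phi i j (c \<cdot>\<^sub>m A + B) = c \<cdot>\<^sub>m Phi i j A + Phi i j B) \<and>
     (\<forall>k. \<forall>R. (\<forall>i<m. psd (da i * k) (R i)) \<longrightarrow>
        (\<forall>j<n. psd (db j * k) (apply_map_id Phi da m db k R j))) \<and>
     (\<forall>R. in_sum da m R \<longrightarrow>
        (\<Sum>j<n. mtrace (apply_map Phi m db R j)) = (\<Sum>i<m. mtrace (R i)))"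

(* M : A (x) B(H1) -> B with A = oplus_{i<m} B(C^(dX i)), B = oplus_{j<n} B(C^(dY j)),
   H1 = H2 = C^d; W a state on H1 (x) H2; the swapped state on H2 (x) H1 is swapW d W. *)
definition swapW :: "nat \<Rightarrow> complex mat \<Rightarrow> complex mat" where
  "swapW d W = mat (d*d) (d*d) (\<lambda>(r,s). W $$ ((r mod d)*d + r div d, (s mod d)*d + s div d))"

definition ent_invertible ::
  "(nat \<Rightarrow> nat) \<Rightarrow> nat \<Rightarrow> (nat \<Rightarrow> nat) \<Rightarrow> nat \<Rightarrow> nat
     \<Rightarrow> (nat \<Rightarrow> nat \<Rightarrow> complex mat \<Rightarrow> complex mat) \<Rightarrow> complex mat \<Rightarrow> bool" where
  "ent_invertible dX m dY n d M W \<longleftrightarrow>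
     (\<exists>N :: nat \<Rightarrow> nat \<Rightarrow> complex mat \<Rightarrow> complex mat.
        is_channel (\<lambda>j. dY j * d) n dX m N \<and>
        (\<forall>\<rho>. in_sum dX m \<rho> \<longrightarrow>
           (\<forall>i<m. apply_map N n dX
              (apply_map_id M (\<lambda>i'. dX i' * d) m dY d (\<lambda>i'. kron (\<rho> i') W)) i = \<rho> i)) \<and>
        (\<forall>\<sigma>. in_sum dY n \<sigma> \<longrightarrow>
           (\<forall>j<n. apply_map M m dY
              (apply_map_id N (\<lambda>j'. dY j' * d) n dX d (\<lambda>j'. kron (\<sigma> j') (swapW d W))) j = \<sigma> j)))"

definition minimal_dilation ::
  "(nat \<Rightarrow> nat) \<Rightarrow> nat \<Rightarrow> (nat \<Rightarrow> nat) \<Rightarrow> nat \<Rightarrow> nat \<Rightarrow> (nat \<Rightarrow> nat \<Rightarrow> nat)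
     \<Rightarrow> (nat \<Rightarrow> nat \<Rightarrow> complex mat \<Rightarrow> complex mat) \<Rightarrow> (nat \<Rightarrow> nat \<Rightarrow> complex mat) \<Rightarrow> bool" where
  "minimal_dilation dX m dY n d dE M \<tau> \<longleftrightarrow>
     (\<forall>i<m. \<forall>j<n.
        \<tau> i j \<in> carrier_mat (dY j * dE j i) (dX i * d) \<and>
        (\<forall>\<rho> \<in> carrier_mat (dX i * d) (dX i * d).
           M i j \<rho> = ptrace2 (dY j) (dE j i) (\<tau> i j * \<rho> * dag (\<tau> i j))) \<and>
        (\<forall>c :: nat \<Rightarrow> complex.
           (\<forall>y<dY j. \<forall>x<dX i * d. (\<Sum>k<dE j i. c k * (\<tau> i j) $$ (y * dE j i + k, x)) = 0)
           \<longrightarrow> (\<forall>k<dE j i. c k = 0)))"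

(* |w_omega> = sum_h |h> (x) omega|h>, W_omega = |w><w| *)
definition W_omega :: "nat \<Rightarrow> complex mat \<Rightarrow> complex mat" where
  "W_omega d \<omega> = mat (d*d) (d*d)
     (\<lambda>(r,s). \<omega> $$ (r mod d, r div d) * cnj (\<omega> $$ (s mod d, s div d)))"

(* Phi_H = |eta><eta| / dim H, |eta> = sum_h |h> (x) |h> *)
definition Phi_max :: "nat \<Rightarrow> complex mat" where
  "Phi_max d = mat (d*d) (d*d)
     (\<lambda>(r,s). (if r div d = r mod d \<and> s div d = s mod d then 1 else 0) / of_nat d)"

end

theory Submission
  imports Defs "Jordan_Normal_Form.Determinant"
begin

text \<open>
  Let $T_{ij}^k$ be the Kraus operators of $M$ read off from the minimal dilation, with the
  $H$-index exposed as $T_{ij,h}^k : X_i \to Y_j$, and let $S_{ji}^l$ be Kraus operators of an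
  inverse channel, with $\omega$ absorbed into their $H$-index. The two inversion equations say
  that all products $\sum_h S_h T_h$ and $\sum_h T_h S_h$ are scalars, because an identity channel
  only has scalar Kraus operators. Since the dilation of $M$ is isometric, this forces
  $S_{ji}^l = \sum_k \mu^l_k (T_{ij}^k)^\dagger$, and minimality together with invertibility of
  $\omega$ makes the coefficient vectors $\mu^l$ span $E_{ji}$. Hence $\tau_i$ is unitary and
  $\sum_h (T_{i'j,h}^{k'})^\dagger T_{ij,h}^k = \delta_{ii'} \Lambda^{k'k} 1$; these
  conditions (\<open>biunitary\<close>) do not mention $\omega$. Trace preservation of the inverse is the
  only place where $\omega$ enters: writing $\tilde T : \bigoplus_i X_i \otimes E_{ji} \to Y_j \otimes H$
  for the reshuffled $T$, it reads $\tilde T G \tilde T^\dagger = 1 \otimes \omega^\dagger\omega$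
  with $G = \sum_l |\mu^l\rangle\langle\mu^l|$ and, multiplied by $\tilde T$, it becomes the
  intertwiner equation with $g = G \Lambda$. Conversely a biunitary with a self-intertwiner $g$
  admits the Gram matrix $G = g \Lambda^{-1}$, which yields the inverse channel. The maximally
  entangled state is the case $\omega = 1/\sqrt{d}$, where the intertwiner is trivial.
\<close>

section \<open>Finite sums and matrix inverses\<close>

text \<open>The obstacle is that the inverse is only given as a channel. Its Kraus operators may be
  redundant, so the coefficient families \<open>\<kappa>\<close> (from S T) and \<open>\<mu>\<close>
  (from T S) are rectangular, and counting dimensions does not show that an isometry is unitary.
  Inversion is replaced by injectivity. A vector annihilated by all S vanishes, because the sum of
  the products of S with its adjoint on the left is 1 \<otimes> \<omega>^*\<omega>, which is
  invertible. Applied to a combination of the T with coefficients c, and followed by minimality,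
  this makes \<open>\<kappa>\<close> injective. The relation \<kappa> = \<mu> \<Lambda> passes
  injectivity on to \<Lambda> and then to \<open>\<mu>\<close>. An identity between the T may
  therefore be tested after contraction with every \<mu>^l, which turns adjoints of T into S, where
  the inversion equations apply. One absorbed family S serves both inversion equations because of
  the swap: in each of them \<omega> is contracted with the H-leg of S from the same side. The two
  entangled states are never compared directly; they communicate only through the biunitarity
  conditions.\<close>

lemma sum_lessThan_add:
  fixes f :: "nat \<Rightarrow> 'a::comm_monoid_add"
  shows "(\<Sum>z<c + b. f z) = (\<Sum>z<c. f z) + (\<Sum>h<b. f (c + h))"
  by (induction b) (simp_all add: add.assoc)

lemma sum_lessThan_mult:
  fixes f :: "nat \<Rightarrow> 'a::comm_monoid_add"
  shows "(\<Sum>z<a * b. f z) = (\<Sum>x<a. \<Sum>h<b. f (x * b + h))"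
proof (induction a)
  case (Suc a)
  have "(\<Sum>z<Suc a * b. f z) = (\<Sum>z<a * b + b. f z)" by (simp add: add.commute)
  also have "\<dots> = (\<Sum>z<a * b. f z) + (\<Sum>h<b. f (a * b + h))"
    by (rule sum_lessThan_add)
  finally show ?case using Suc by simp
qed simp

lemma index_less_mult: "x < a \<Longrightarrow> h < b \<Longrightarrow> x * b + h < a * (b::nat)"
proof -
  assume "x < a" "h < b"
  then have "x * b + h < x * b + b" by simp
  also have "\<dots> = Suc x * b" by simp
  also have "\<dots> \<le> a * b" using \<open>x < a\<close> by (intro mult_le_mono1) simp
  finally show ?thesis .
qed

text \<open>Associativity of contraction, used mostly when the bracket is a resolution of the
  identity. The ranges \<open>K j\<close> and \<open>Y j\<close> depend on \<open>j\<close>, so the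
  fixed ranges \<open>X\<close> and \<open>H\<close> are the ones that move.\<close>

lemma sum_exchange_3_2:
  fixes s :: "'x \<Rightarrow> 'h \<Rightarrow> complex"
  shows "(\<Sum>x\<in>X. \<Sum>h\<in>H. (\<Sum>j\<in>J. \<Sum>k\<in>K j. \<Sum>y\<in>Y j. a j k y * b j k y x h) * s x h)
    = (\<Sum>j\<in>J. \<Sum>k\<in>K j. \<Sum>y\<in>Y j. a j k y * (\<Sum>x\<in>X. \<Sum>h\<in>H. b j k y x h * s x h))"
proof -
  have "(\<Sum>x\<in>X. \<Sum>h\<in>H. (\<Sum>j\<in>J. \<Sum>k\<in>K j. \<Sum>y\<in>Y j. a j k y * b j k y x h) * s x h)
    = (\<Sum>x\<in>X. \<Sum>j\<in>J. \<Sum>k\<in>K j. \<Sum>y\<in>Y j. \<Sum>h\<in>H. a j k y * b j k y x h * s x h)"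
    unfolding sum_distrib_right by (simp only: sum.swap[of _ _ H])
  also have "\<dots> = (\<Sum>j\<in>J. \<Sum>k\<in>K j. \<Sum>y\<in>Y j. \<Sum>x\<in>X. \<Sum>h\<in>H. a j k y * b j k y x h * s x h)"
    by (simp only: sum.swap[of _ _ X])
  finally show ?thesis by (simp add: sum_distrib_left mult.assoc)
qed

lemma sum_swap_3:
  "(\<Sum>j\<in>J. \<Sum>k\<in>K j. \<Sum>y\<in>Y j. \<Sum>a\<in>A. f j k y a) = (\<Sum>a\<in>A. \<Sum>j\<in>J. \<Sum>k\<in>K j. \<Sum>y\<in>Y j. f j k y a)"
  by (simp only: sum.swap[of _ _ A])

lemma sum_exchange_1_2:
  fixes s :: "'x \<Rightarrow> 'h \<Rightarrow> complex"
  shows "(\<Sum>x\<in>X. \<Sum>h\<in>H. (\<Sum>k\<in>K. a k * b k x h) * s x h)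
    = (\<Sum>k\<in>K. a k * (\<Sum>x\<in>X. \<Sum>h\<in>H. b k x h * s x h))"
proof -
  have "(\<Sum>x\<in>X. \<Sum>h\<in>H. (\<Sum>k\<in>K. a k * b k x h) * s x h)
    = (\<Sum>x\<in>X. \<Sum>k\<in>K. \<Sum>h\<in>H. a k * b k x h * s x h)"
    unfolding sum_distrib_right by (simp only: sum.swap[of _ _ H])
  also have "\<dots> = (\<Sum>k\<in>K. \<Sum>x\<in>X. \<Sum>h\<in>H. a k * b k x h * s x h)"
    by (simp only: sum.swap[of _ _ X])
  finally show ?thesis by (simp add: sum_distrib_left mult.assoc)
qed

text \<open>Associativity of row times matrix times column. It carries most of the matrix algebra
  below, where matrices are plain functions.\<close>

lemma sum_mult_exchange:
  fixes c :: "'b \<Rightarrow> complex"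
  shows "(\<Sum>a\<in>A. f a * (\<Sum>b\<in>B. g a b * c b)) = (\<Sum>b\<in>B. (\<Sum>a\<in>A. f a * g a b) * c b)"
  unfolding sum_distrib_left sum_distrib_right by (subst sum.swap) (simp add: mult.assoc)

lemma sum_delta_mult:
  fixes f :: "nat \<Rightarrow> complex"
  assumes "a < e"
  shows "(\<Sum>k<e. (if a = k then 1 else 0) * f k) = f a" "(\<Sum>k<e. (if k = a then 1 else 0) * f k) = f a"
    "(\<Sum>k<e. f k * (if a = k then 1 else 0)) = f a" "(\<Sum>k<e. f k * (if k = a then 1 else 0)) = f a"
  using assms by (simp_all add: if_distrib[of "\<lambda>z. z * _"] if_distrib[of "\<lambda>z. _ * z"] cong: if_cong)

lemma sum_delta2_mult:
  fixes f :: "nat \<Rightarrow> nat \<Rightarrow> complex"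
  assumes "x < a" "h < b"
  shows "(\<Sum>x'<a. \<Sum>h'<b. (if x = x' \<and> h = h' then 1 else 0) * f x' h') = f x h"
proof -
  have "(\<Sum>x'<a. \<Sum>h'<b. (if x = x' \<and> h = h' then 1 else 0) * f x' h')
    = (\<Sum>x'<a. if x = x' then \<Sum>h'<b. (if h = h' then 1 else 0) * f x' h' else 0)"
    by (intro sum.cong refl) auto
  then show ?thesis using assms by (simp add: sum_delta_mult)
qed

text \<open>A trivial kernel forces a nonzero determinant, and a nonzero determinant makes the
  matrix a unit of the matrix ring, so the inverse is two-sided.\<close>

lemma injective_imp_inverse:
  fixes A :: "nat \<Rightarrow> nat \<Rightarrow> complex"
  assumes inj: "\<And>c. (\<And>a. a < e \<Longrightarrow> (\<Sum>b<e. A a b * c b) = 0) \<Longrightarrow> \<forall>b<e. c b = 0"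
  obtains P where "\<And>a b. a < e \<Longrightarrow> b < e \<Longrightarrow> (\<Sum>k<e. A a k * P k b) = (if a = b then 1 else 0)"
    and "\<And>a b. a < e \<Longrightarrow> b < e \<Longrightarrow> (\<Sum>k<e. P a k * A k b) = (if a = b then 1 else 0)"
proof -
  let ?A = "mat e e (\<lambda>(a, b). A a b)"
  have "det ?A \<noteq> 0"
  proof
    assume "det ?A = 0"
    then obtain v where v: "v \<in> carrier_vec e" "v \<noteq> 0\<^sub>v e" "?A *\<^sub>v v = 0\<^sub>v e"
      using det_0_iff_vec_prod_zero_field[of ?A e] by auto
    have "\<forall>b<e. v $ b = 0"
    proof (rule inj)
      fix a assume "a < e"
      then have "(?A *\<^sub>v v) $ a = (\<Sum>b<e. A a b * v $ b)"
        using v(1) by (auto simp: scalar_prod_def lessThan_atLeast0)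
      then show "(\<Sum>b<e. A a b * v $ b) = 0" using v(3) \<open>a < e\<close> by simp
    qed
    then have "v = 0\<^sub>v e" using v(1) by auto
    then show False using v(2) by simp
  qed
  then obtain B where B: "B \<in> carrier_mat e e" "?A * B = 1\<^sub>m e" "B * ?A = 1\<^sub>m e"
    using det_non_zero_imp_unit[of ?A e "()"] by (auto simp: Units_def ring_mat_def)
  show thesis
  proof
    fix a b assume ab: "a < e" "b < e"
    have "(?A * B) $$ (a, b) = (\<Sum>k<e. A a k * B $$ (k, b))"
      using ab B(1) by (auto simp: scalar_prod_def lessThan_atLeast0)
    then show "(\<Sum>k<e. A a k * B $$ (k, b)) = (if a = b then 1 else 0)" using B(2) ab by simp
    have "(B * ?A) $$ (a, b) = (\<Sum>k<e. B $$ (a, k) * A k b)"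
      using ab B(1) by (auto simp: scalar_prod_def lessThan_atLeast0)
    then show "(\<Sum>k<e. B $$ (a, k) * A k b) = (if a = b then 1 else 0)" using B(3) ab by simp
  qed
qed

section \<open>Kraus families\<close>

lemma psd_iff:
  "psd n A \<longleftrightarrow> A \<in> carrier_mat n n \<and>
     (\<forall>v. \<exists>r::real. r \<ge> 0 \<and> (\<Sum>x<n. \<Sum>y<n. cnj (v x) * A $$ (x, y) * v y) = complex_of_real r)"
proof -
  have e: "conjugate (vec n v) \<bullet> (A *\<^sub>v vec n v) = (\<Sum>x<n. \<Sum>y<n. cnj (v x) * A $$ (x, y) * v y)"
    if "A \<in> carrier_mat n n" for v
    using that by (auto simp: scalar_prod_def lessThan_atLeast0 sum_distrib_left mult.assoc intro!: sum.cong)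
  show ?thesis
  proof (cases "A \<in> carrier_mat n n")
    case True
    have "(\<forall>v\<in>carrier_vec n. Q v) \<longleftrightarrow> (\<forall>v. Q (vec n v))" for Q :: "complex vec \<Rightarrow> bool"
    proof
      assume a: "\<forall>v. Q (vec n v)"
      show "\<forall>v\<in>carrier_vec n. Q v"
      proof
        fix v :: "complex vec" assume "v \<in> carrier_vec n"
        then have "vec n (\<lambda>i. v $ i) = v" by auto
        then show "Q v" using a by metis
      qed
    qed simp
    from this[of "\<lambda>v. \<exists>r::real. r \<ge> 0 \<and> (conjugate v) \<bullet> (A *\<^sub>v v) = complex_of_real r"]
    show ?thesis unfolding psd_def e[OF True] using True by blast
  qed (simp add: psd_def)
qed

text \<open>A Cholesky factorisation by induction on the index set: each step splits off one index
  and passes to the Schur complement. Hermitian symmetry is not assumed; it is extracted from the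
  reality of the form.\<close>

lemma psd_form_Gram:
  fixes A :: "'a \<Rightarrow> 'a \<Rightarrow> complex"
  assumes "finite I"
    and "\<And>v. \<exists>r::real. r \<ge> 0 \<and> (\<Sum>x\<in>I. \<Sum>y\<in>I. cnj (v x) * A x y * v y) = complex_of_real r"
  shows "\<exists>w. \<forall>x\<in>I. \<forall>y\<in>I. A x y = (\<Sum>l\<in>I. w l x * cnj (w l y))"
  using assms
proof (induction I arbitrary: A rule: finite_induct)
  case empty
  then show ?case by simp
next
  case (insert a I)
  have a: "a \<notin> I" "finite I" using insert by auto
  define q where "q v = (\<Sum>x\<in>insert a I. \<Sum>y\<in>insert a I. cnj (v x) * A x y * v y)" for v
  have q: "\<exists>r::real. r \<ge> 0 \<and> q v = complex_of_real r" for v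
    using insert.prems unfolding q_def by simp
  have q_sub: "q v = (\<Sum>x\<in>K. \<Sum>y\<in>K. cnj (v x) * A x y * v y)"
    if "K \<subseteq> insert a I" "\<And>x. x \<notin> K \<Longrightarrow> v x = 0" for v K
    unfolding q_def using that a
    by (intro sum.mono_neutral_cong_right) (auto intro!: sum.neutral sum.mono_neutral_right)
  have "\<exists>\<alpha>::real. \<alpha> \<ge> 0 \<and> A a a = complex_of_real \<alpha>"
    using q[of "\<lambda>x. if x = a then 1 else 0"] q_sub[of "{a}" "\<lambda>x. if x = a then 1 else 0"] by auto
  then obtain \<alpha> :: real where \<alpha>: "\<alpha> \<ge> 0" "A a a = complex_of_real \<alpha>" by blast
  have q2: "\<exists>r::real. r \<ge> 0 \<and> cnj s * \<alpha> * s + cnj s * A a x * t + cnj t * A x a * s + cnj t * A x x * t = complex_of_real r"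
    if x: "x \<in> I" for x s t
  proof -
    let ?v = "\<lambda>z. if z = a then s else if z = x then t else 0"
    have "x \<noteq> a" using x a by auto
    then have "q ?v = cnj s * \<alpha> * s + cnj s * A a x * t + cnj t * A x a * s + cnj t * A x x * t"
      using x by (subst q_sub[of "{a, x}"]) (auto simp: \<alpha> algebra_simps)
    then show ?thesis using q[of ?v] by simp
  qed
  \<comment> \<open>Polarisation: the test vectors (0,1), (1,1) and (1,\<i>) make the sum of the two
    off-diagonal entries real and their difference imaginary.\<close>
  have herm: "A x a = cnj (A a x)" if x: "x \<in> I" for x
  proof -
    obtain r0 where "A x x = complex_of_real r0" using q2[OF x, of 0 1] by auto
    moreover obtain r1 where "\<alpha> + A a x + A x a + A x x = complex_of_real r1" using q2[OF x, of 1 1] by auto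
    moreover obtain r2 where "\<alpha> + A a x * \<i> - \<i> * A x a + A x x = complex_of_real r2"
      using q2[OF x, of 1 \<i>] by (auto simp: algebra_simps)
    ultimately show ?thesis by (auto simp: complex_eq_iff)
  qed
  have zero: "A a x = 0" if x: "x \<in> I" and "\<alpha> = 0" for x
  proof (rule ccontr)
    assume nz: "A a x \<noteq> 0"
    obtain r0 where r0: "A x x = complex_of_real r0" using q2[OF x, of 0 1] by auto
    define c where "c = (cmod (A a x))\<^sup>2"
    have c: "c > 0" using nz by (simp add: c_def)
    have cc: "cnj (A a x) * A a x = complex_of_real c"
      unfolding c_def by (metis complex_norm_square mult.commute)
    \<comment> \<open>Chosen so that the form takes the value -1 at this test vector.\<close>
    define N where "N = (r0 + 1) / (2 * c)"
    obtain r where r: "r \<ge> 0" "cnj (- of_real N * A a x) * A a x + cnj (A a x) * (- of_real N * A a x) + A x x = complex_of_real r"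
      using q2[OF x, of "- of_real N * A a x" 1] herm[OF x] \<open>\<alpha> = 0\<close> by auto
    have "cnj (- of_real N * A a x) * A a x + cnj (A a x) * (- of_real N * A a x) + A x x
      = - 2 * of_real N * (cnj (A a x) * A a x) + A x x" by (simp add: algebra_simps)
    also have "\<dots> = complex_of_real (- 2 * N * c + r0)" by (simp add: cc r0)
    finally have "r = - 2 * N * c + r0" using r(2) by (metis of_real_eq_iff)
    then show False using r(1) c by (simp add: N_def field_simps)
  qed
  \<comment> \<open>Schur complement of the entry at \<open>a\<close>; division by zero makes it \<open>A\<close> itself when \<open>\<alpha> = 0\<close>.\<close>
  define A' where "A' x y = A x y - A x a * A a y / \<alpha>" for x y
  have "\<exists>w. \<forall>x\<in>I. \<forall>y\<in>I. A' x y = (\<Sum>l\<in>I. w l x * cnj (w l y))"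
  proof (rule insert.IH)
    fix v :: "'a \<Rightarrow> complex"
    define B where "B = (\<Sum>y\<in>I. A a y * v y)"
    \<comment> \<open>The value at \<open>a\<close> completes the square, so that the form at
      \<open>v'\<close> equals the Schur complement at \<open>v\<close>. For \<alpha> = 0 the
      quotient is 0 and \<open>v'\<close> is \<open>v\<close> extended by zero.\<close>
    define v' where "v' x = (if x = a then - B / \<alpha> else v x)" for x
    have v': "v' a = - B / \<alpha>" "\<And>x. x \<in> I \<Longrightarrow> v' x = v x" using a by (auto simp: v'_def)
    have cB: "(\<Sum>x\<in>I. cnj (v x) * A x a) = cnj B"
      unfolding B_def by (simp add: herm mult.commute)
    have "q v' = cnj (v' a) * \<alpha> * v' a + (\<Sum>y\<in>I. cnj (v' a) * A a y * v y)
        + ((\<Sum>x\<in>I. cnj (v x) * A x a * v' a) + (\<Sum>x\<in>I. \<Sum>y\<in>I. cnj (v x) * A x y * v y))"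
      unfolding q_def sum.distrib[symmetric] using a v'(2) by (simp add: \<alpha>)
    also have "(\<Sum>y\<in>I. cnj (v' a) * A a y * v y) = cnj (v' a) * B"
      unfolding B_def by (simp only: sum_distrib_left mult.assoc)
    also have "(\<Sum>x\<in>I. cnj (v x) * A x a * v' a) = cnj B * v' a"
      by (simp only: cB[symmetric] sum_distrib_right)
    also have "cnj (v' a) * \<alpha> * v' a + cnj (v' a) * B + (cnj B * v' a + (\<Sum>x\<in>I. \<Sum>y\<in>I. cnj (v x) * A x y * v y))
      = (\<Sum>x\<in>I. \<Sum>y\<in>I. cnj (v x) * A x y * v y) - cnj B * B / \<alpha>"
      by (cases "\<alpha> = 0") (simp_all add: v' field_simps)
    also have "cnj B * B / \<alpha> = (\<Sum>x\<in>I. \<Sum>y\<in>I. cnj (v x) * (A x a * A a y / \<alpha>) * v y)"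
      unfolding cB[symmetric] unfolding B_def sum_product sum_divide_distrib
      by (intro sum.cong refl) simp
    finally have "q v' = (\<Sum>x\<in>I. \<Sum>y\<in>I. cnj (v x) * A' x y * v y)"
      unfolding A'_def by (simp add: sum_subtractf[symmetric] algebra_simps)
    then show "\<exists>r::real. r \<ge> 0 \<and> (\<Sum>x\<in>I. \<Sum>y\<in>I. cnj (v x) * A' x y * v y) = complex_of_real r"
      using q[of v'] by simp
  qed
  then obtain w where w: "\<And>x y. x \<in> I \<Longrightarrow> y \<in> I \<Longrightarrow> A' x y = (\<Sum>l\<in>I. w l x * cnj (w l y))" by blast
  \<comment> \<open>The new Gram vector is column \<open>a\<close> divided by sqrt \<alpha>, and the
    old ones vanish at \<open>a\<close>. For \<alpha> = 0 the new vector is 0, which is consistent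
    because \<open>zero\<close> kills the row and \<open>herm\<close> the column.\<close>
  define w' where "w' l x = (if l = a then A x a / sqrt \<alpha> else if x = a then 0 else w l x)" for l x
  have w'_sum: "(\<Sum>l\<in>insert a I. w' l x * cnj (w' l y))
      = A x a * cnj (A y a) / \<alpha> + (\<Sum>l\<in>I. (if x = a then 0 else w l x) * cnj (if y = a then 0 else w l y))" for x y
  proof -
    have "complex_of_real (sqrt \<alpha>) * complex_of_real (sqrt \<alpha>) = complex_of_real \<alpha>"
      using \<alpha>(1) by (simp flip: of_real_mult)
    moreover have "(\<Sum>l\<in>I. w' l x * cnj (w' l y)) = (\<Sum>l\<in>I. (if x = a then 0 else w l x) * cnj (if y = a then 0 else w l y))"
      using a by (intro sum.cong refl) (auto simp: w'_def)
    ultimately show ?thesis using a by (simp add: w'_def)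
  qed
  have "A x y = (\<Sum>l\<in>insert a I. w' l x * cnj (w' l y))" if "x \<in> insert a I" "y \<in> insert a I" for x y
  proof -
    consider "x = a" "y = a" | "x = a" "y \<in> I" | "x \<in> I" "y = a" | "x \<in> I" "y \<in> I" using \<open>x \<in> insert a I\<close> \<open>y \<in> insert a I\<close> by blast
    then show ?thesis
    proof cases
      case 1
      then show ?thesis unfolding w'_sum using \<alpha> by simp
    next
      case 2
      then have "y \<noteq> a" using a by auto
      then show ?thesis unfolding w'_sum using 2 \<alpha> zero[OF 2(2)] herm[OF 2(2)] by simp
    next
      case 3
      then have "x \<noteq> a" using a by auto
      then show ?thesis unfolding w'_sum using 3 \<alpha> zero[OF 3(1)] herm[OF 3(1)] by simp
    next
      case 4
      then have "x \<noteq> a" "y \<noteq> a" using a by auto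
      then show ?thesis unfolding w'_sum using 4 w[OF 4] herm[OF 4(2)] by (simp add: A'_def diff_eq_eq add.commute)
    qed
  qed
  then show ?case by blast
qed


section \<open>Kraus operators of channels between direct sums\<close>

definition kraus_family :: "(nat \<Rightarrow> nat) \<Rightarrow> nat \<Rightarrow> (nat \<Rightarrow> nat) \<Rightarrow> nat \<Rightarrow> (nat \<Rightarrow> nat \<Rightarrow> 'l set)
    \<Rightarrow> (nat \<Rightarrow> nat \<Rightarrow> 'l \<Rightarrow> nat \<Rightarrow> nat \<Rightarrow> complex) \<Rightarrow> (nat \<Rightarrow> nat \<Rightarrow> complex mat \<Rightarrow> complex mat) \<Rightarrow> bool" where
  "kraus_family a m b n L K \<Phi> \<longleftrightarrow> (\<forall>i<m. \<forall>j<n. \<forall>R \<in> carrier_mat (a i) (a i).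
     \<Phi> i j R = mat (b j) (b j) (\<lambda>(r, s). \<Sum>l\<in>L i j. \<Sum>u<a i. \<Sum>v<a i.
       K i j l r u * R $$ (u, v) * cnj (K i j l s v)))"

definition kraus_tp :: "(nat \<Rightarrow> nat) \<Rightarrow> nat \<Rightarrow> (nat \<Rightarrow> nat) \<Rightarrow> nat \<Rightarrow> (nat \<Rightarrow> nat \<Rightarrow> 'l set)
    \<Rightarrow> (nat \<Rightarrow> nat \<Rightarrow> 'l \<Rightarrow> nat \<Rightarrow> nat \<Rightarrow> complex) \<Rightarrow> bool" where
  "kraus_tp a m b n L K \<longleftrightarrow> (\<forall>i<m. \<forall>u<a i. \<forall>v<a i.
     (\<Sum>j<n. \<Sum>l\<in>L i j. \<Sum>r<b j. cnj (K i j l r u) * K i j l r v) = (if u = v then 1 else 0))"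

lemma kraus_family_index:
  assumes "kraus_family a m b n L K \<Phi>" "i < m" "j < n" "R \<in> carrier_mat (a i) (a i)" "r < b j" "s < b j"
  shows "\<Phi> i j R $$ (r, s) = (\<Sum>l\<in>L i j. \<Sum>u<a i. \<Sum>v<a i. K i j l r u * R $$ (u, v) * cnj (K i j l s v))"
  using assms unfolding kraus_family_def by auto

lemma blk_carrier [simp]: "blk a k R p q \<in> carrier_mat a a"
  by (simp add: blk_def)

lemma apply_map_id_index:
  assumes "r < b j" "s < b j" "p < k" "q < k"
  shows "apply_map_id \<Phi> a m b k R j $$ (r * k + p, s * k + q) = (\<Sum>i<m. \<Phi> i j (blk (a i) k (R i) p q) $$ (r, s))"
  using assms by (simp add: apply_map_id_def apply_map_def tensor_id_def index_less_mult)

lemma is_channel_linear: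
  assumes "is_channel a m b n \<Phi>" "i < m" "j < n" "A \<in> carrier_mat (a i) (a i)" "B \<in> carrier_mat (a i) (a i)"
  shows "\<Phi> i j A \<in> carrier_mat (b j) (b j)" "\<Phi> i j (c \<cdot>\<^sub>m A + B) = c \<cdot>\<^sub>m \<Phi> i j A + \<Phi> i j B"
  using assms unfolding is_channel_def by blast+

lemma is_channel_zero:
  assumes "is_channel a m b n \<Phi>" "i < m" "j < n" "r < b j" "s < b j"
  shows "\<Phi> i j (0\<^sub>m (a i) (a i)) $$ (r, s) = 0"
proof -
  let ?Z = "0\<^sub>m (a i) (a i) :: complex mat"
  have c: "\<Phi> i j ?Z \<in> carrier_mat (b j) (b j)" using is_channel_linear(1)[OF assms(1-3), of ?Z ?Z] by simp
  have "1 \<cdot>\<^sub>m ?Z + ?Z = ?Z" by auto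
  then have "\<Phi> i j ?Z = 1 \<cdot>\<^sub>m \<Phi> i j ?Z + \<Phi> i j ?Z"
    using is_channel_linear(2)[OF assms(1-3), of ?Z ?Z 1] by simp
  then have "\<Phi> i j ?Z $$ (r, s) = (1 \<cdot>\<^sub>m \<Phi> i j ?Z + \<Phi> i j ?Z) $$ (r, s)" by simp
  also have "\<dots> = \<Phi> i j ?Z $$ (r, s) + \<Phi> i j ?Z $$ (r, s)" using c assms by auto
  finally show ?thesis by simp
qed

abbreviation mat_unit :: "nat \<Rightarrow> nat \<Rightarrow> nat \<Rightarrow> complex mat" where
  "mat_unit a u v \<equiv> mat a a (\<lambda>(x, y). if x = u \<and> y = v then 1 else 0)"

text \<open>Linearity is available only in the form \<open>c \<cdot>\<^sub>m A + B\<close>, hence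
  the induction over the set \<open>F\<close> of entries of \<open>R\<close> that are kept.\<close>

lemma is_channel_expand:
  assumes ch: "is_channel a m b n \<Phi>" and ij: "i < m" "j < n" and R: "R \<in> carrier_mat (a i) (a i)"
    and rs: "r < b j" "s < b j"
  shows "\<Phi> i j R $$ (r, s) = (\<Sum>u<a i. \<Sum>v<a i. R $$ (u, v) * \<Phi> i j (mat_unit (a i) u v) $$ (r, s))"
proof -
  have part: "\<Phi> i j (mat (a i) (a i) (\<lambda>z. if z \<in> F then R $$ z else 0)) $$ (r, s)
    = (\<Sum>z\<in>F. R $$ z * \<Phi> i j (mat_unit (a i) (fst z) (snd z)) $$ (r, s))" if "finite F" for F
    using that
  proof (induction F rule: finite_induct)
    case empty
    have "mat (a i) (a i) (\<lambda>z. if z \<in> {} then R $$ z else 0) = 0\<^sub>m (a i) (a i)" by auto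
    then show ?case using is_channel_zero[OF ch ij rs] by simp
  next
    case (insert z F)
    let ?A = "mat_unit (a i) (fst z) (snd z)" and ?B = "mat (a i) (a i) (\<lambda>z. if z \<in> F then R $$ z else 0)"
    have c: "\<Phi> i j ?A \<in> carrier_mat (b j) (b j)" "\<Phi> i j ?B \<in> carrier_mat (b j) (b j)"
      using is_channel_linear(1)[OF ch ij, of ?A ?A] is_channel_linear(1)[OF ch ij, of ?B ?B] by auto
    have "mat (a i) (a i) (\<lambda>y. if y \<in> insert z F then R $$ y else 0) = R $$ z \<cdot>\<^sub>m ?A + ?B"
      using insert.hyps by (intro eq_matI) (auto simp: prod_eq_iff)
    then show ?case
      using is_channel_linear(2)[OF ch ij, of ?A ?B "R $$ z"] c rs insert by simp
  qed
  have "mat (a i) (a i) (\<lambda>z. if z \<in> {..<a i} \<times> {..<a i} then R $$ z else 0) = R"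
    using R by (intro eq_matI) auto
  then show ?thesis using part[of "{..<a i} \<times> {..<a i}"] by (simp add: sum.cartesian_product case_prod_unfold)
qed

text \<open>Choi's theorem. The channel with an ancilla of the dimension of block \<open>i\<close>
  sends a positive operator to the Choi matrix of the component from \<open>i\<close> to
  \<open>j\<close>; the Gram vectors of that matrix, reshaped, are the Kraus operators.\<close>

lemma kraus_family_exists:
  assumes ch: "is_channel a m b n \<Phi>"
  shows "\<exists>K. kraus_family a m b n (\<lambda>i j. {..<b j * a i}) K \<Phi>"
proof -
  have "\<exists>w :: nat \<Rightarrow> nat \<Rightarrow> complex. \<forall>r<b j. \<forall>s<b j. \<forall>p<a i. \<forall>q<a i. \<Phi> i j (mat_unit (a i) p q) $$ (r, s)
      = (\<Sum>l<b j * a i. w l (r * a i + p) * cnj (w l (s * a i + q)))" if ij: "i < m" "j < n" for i j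
  proof -
    define k where "k = a i"
    \<comment> \<open>the Choi input: the unnormalised maximally entangled operator, placed in block \<open>i\<close> only\<close>
    define Ch where "Ch i' = (if i' = i then mat (k * k) (k * k)
        (\<lambda>(r, s). if r div k = r mod k \<and> s div k = s mod k then 1 else 0)
      else 0\<^sub>m (a i' * k) (a i' * k) :: complex mat)" for i' :: nat
    have "psd (a i' * k) (Ch i')" for i'
    proof (cases "i' = i")
      case False
      then show ?thesis by (auto simp: psd_iff Ch_def intro!: exI[of _ 0])
    next
      case True
      have "(\<Sum>x<k * k. \<Sum>y<k * k. cnj (v x) * Ch i $$ (x, y) * v y)
        = complex_of_real ((cmod (\<Sum>y<k * k. if y div k = y mod k then v y else 0))\<^sup>2)" for v
      proof -
        have "(\<Sum>x<k * k. \<Sum>y<k * k. cnj (v x) * Ch i $$ (x, y) * v y)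
          = (\<Sum>x<k * k. \<Sum>y<k * k. (if x div k = x mod k then cnj (v x) else 0) * (if y div k = y mod k then v y else 0))"
          by (intro sum.cong refl) (auto simp: Ch_def)
        also have "\<dots> = cnj (\<Sum>y<k * k. if y div k = y mod k then v y else 0) * (\<Sum>y<k * k. if y div k = y mod k then v y else 0)"
          by (simp add: sum_product if_distrib[of cnj] cong: if_cong)
        also have "\<dots> = complex_of_real ((cmod (\<Sum>y<k * k. if y div k = y mod k then v y else 0))\<^sup>2)"
          by (subst complex_norm_square) (rule mult.commute)
        finally show ?thesis .
      qed
      then show ?thesis using True unfolding psd_iff
        by (auto simp: Ch_def k_def intro!: exI[of _ "(cmod _)\<^sup>2"])
    qed
    then have "psd (b j * k) (apply_map_id \<Phi> a m b k Ch j)"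
      using ch ij(2) unfolding is_channel_def by blast
    then obtain w where w: "\<And>x y. x < b j * k \<Longrightarrow> y < b j * k \<Longrightarrow>
        apply_map_id \<Phi> a m b k Ch j $$ (x, y) = (\<Sum>l<b j * k. w l x * cnj (w l y))"
      using psd_form_Gram[of "{..<b j * k}" "\<lambda>x y. apply_map_id \<Phi> a m b k Ch j $$ (x, y)"]
      unfolding psd_iff by auto
    have "\<Phi> i j (mat_unit k p q) $$ (r, s) = apply_map_id \<Phi> a m b k Ch j $$ (r * k + p, s * k + q)"
      if rs: "r < b j" "s < b j" and pq: "p < k" "q < k" for r s p q
    proof -
      \<comment> \<open>The ancilla block (p,q) of the Choi input is the matrix unit at (p,q), so
        the output lists the images of all matrix units.\<close>
      have B: "blk (a i') k (Ch i') p q = (if i' = i then mat_unit k p q else 0\<^sub>m (a i') (a i'))" for i'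
        using pq by (auto simp: blk_def Ch_def k_def[symmetric] index_less_mult intro!: eq_matI)
      have "apply_map_id \<Phi> a m b k Ch j $$ (r * k + p, s * k + q)
        = (\<Sum>i'<m. if i' = i then \<Phi> i j (mat_unit k p q) $$ (r, s) else 0)"
        unfolding apply_map_id_index[of r b j s p k q, OF rs pq] B
        using is_channel_zero[OF ch _ ij(2) rs] by (intro sum.cong refl) auto
      then show ?thesis using ij by simp
    qed
    then show ?thesis using w unfolding k_def[symmetric]
      by (intro exI[of _ w]) (simp add: index_less_mult)
  qed
  then have "\<exists>w :: nat \<Rightarrow> nat \<Rightarrow> nat \<Rightarrow> nat \<Rightarrow> complex. \<forall>i<m. \<forall>j<n. \<forall>r<b j. \<forall>s<b j. \<forall>p<a i. \<forall>q<a i.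
      \<Phi> i j (mat_unit (a i) p q) $$ (r, s) = (\<Sum>l<b j * a i. w i j l (r * a i + p) * cnj (w i j l (s * a i + q)))"
    by meson
  then obtain w :: "nat \<Rightarrow> nat \<Rightarrow> nat \<Rightarrow> nat \<Rightarrow> complex" where w:
    "\<And>i j r s p q. i < m \<Longrightarrow> j < n \<Longrightarrow> r < b j \<Longrightarrow> s < b j \<Longrightarrow> p < a i \<Longrightarrow> q < a i \<Longrightarrow>
      \<Phi> i j (mat_unit (a i) p q) $$ (r, s) = (\<Sum>l<b j * a i. w i j l (r * a i + p) * cnj (w i j l (s * a i + q)))"
    by blast
  have "kraus_family a m b n (\<lambda>i j. {..<b j * a i}) (\<lambda>i j l r p. w i j l (r * a i + p)) \<Phi>"
    unfolding kraus_family_def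
  proof (intro allI impI ballI)
    fix i j and R :: "complex mat" assume ij: "i < m" "j < n" and R: "R \<in> carrier_mat (a i) (a i)"
    have c: "\<Phi> i j R \<in> carrier_mat (b j) (b j)" using is_channel_linear(1)[OF ch ij R R] .
    show "\<Phi> i j R = mat (b j) (b j) (\<lambda>(r, s). \<Sum>l<b j * a i. \<Sum>u<a i. \<Sum>v<a i.
        w i j l (r * a i + u) * R $$ (u, v) * cnj (w i j l (s * a i + v)))"
    proof (rule eq_matI)
      fix r s assume "r < dim_row (mat (b j) (b j) (\<lambda>(r, s). \<Sum>l<b j * a i. \<Sum>u<a i. \<Sum>v<a i.
        w i j l (r * a i + u) * R $$ (u, v) * cnj (w i j l (s * a i + v))))"
        "s < dim_col (mat (b j) (b j) (\<lambda>(r, s). \<Sum>l<b j * a i. \<Sum>u<a i. \<Sum>v<a i.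
        w i j l (r * a i + u) * R $$ (u, v) * cnj (w i j l (s * a i + v))))"
      then have rs: "r < b j" "s < b j" by auto
      have "\<Phi> i j R $$ (r, s) = (\<Sum>u<a i. \<Sum>v<a i. \<Sum>l<b j * a i.
          w i j l (r * a i + u) * R $$ (u, v) * cnj (w i j l (s * a i + v)))"
        unfolding is_channel_expand[OF ch ij R rs] using ij rs
        by (intro sum.cong refl) (simp add: w sum_distrib_left mult_ac)
      also have "\<dots> = (\<Sum>u<a i. \<Sum>l<b j * a i. \<Sum>v<a i.
          w i j l (r * a i + u) * R $$ (u, v) * cnj (w i j l (s * a i + v)))"
        by (rule sum.cong[OF refl]) (rule sum.swap)
      also have "\<dots> = (\<Sum>l<b j * a i. \<Sum>u<a i. \<Sum>v<a i.
          w i j l (r * a i + u) * R $$ (u, v) * cnj (w i j l (s * a i + v)))"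
        by (rule sum.swap)
      finally show "\<Phi> i j R $$ (r, s) = mat (b j) (b j) (\<lambda>(r, s). \<Sum>l<b j * a i. \<Sum>u<a i. \<Sum>v<a i.
          w i j l (r * a i + u) * R $$ (u, v) * cnj (w i j l (s * a i + v))) $$ (r, s)"
        using rs by simp
    qed (use c in auto)
  qed
  then show ?thesis by blast
qed

lemma kraus_trace:
  assumes kf: "kraus_family a m b n L K \<Phi>" and R: "in_sum a m R"
  shows "(\<Sum>j<n. mtrace (apply_map \<Phi> m b R j))
    = (\<Sum>i<m. \<Sum>u<a i. \<Sum>v<a i. R i $$ (u, v) * (\<Sum>j<n. \<Sum>l\<in>L i j. \<Sum>r<b j. cnj (K i j l r v) * K i j l r u))"
proof -
  have "mtrace (apply_map \<Phi> m b R j)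
    = (\<Sum>i<m. \<Sum>l\<in>L i j. \<Sum>r<b j. \<Sum>u<a i. \<Sum>v<a i. R i $$ (u, v) * (cnj (K i j l r v) * K i j l r u))"
    if "j < n" for j
  proof -
    have "mtrace (apply_map \<Phi> m b R j) = (\<Sum>r<b j. \<Sum>i<m. \<Phi> i j (R i) $$ (r, r))"
      by (simp add: mtrace_def apply_map_def)
    also have "\<dots> = (\<Sum>r<b j. \<Sum>i<m. \<Sum>l\<in>L i j. \<Sum>u<a i. \<Sum>v<a i. R i $$ (u, v) * (cnj (K i j l r v) * K i j l r u))"
      using R that by (intro sum.cong refl) (simp add: kraus_family_index[OF kf] in_sum_def mult_ac)
    also have "\<dots> = (\<Sum>i<m. \<Sum>r<b j. \<Sum>l\<in>L i j. \<Sum>u<a i. \<Sum>v<a i. R i $$ (u, v) * (cnj (K i j l r v) * K i j l r u))"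
      by (rule sum.swap)
    also have "\<dots> = (\<Sum>i<m. \<Sum>l\<in>L i j. \<Sum>r<b j. \<Sum>u<a i. \<Sum>v<a i. R i $$ (u, v) * (cnj (K i j l r v) * K i j l r u))"
      by (rule sum.cong[OF refl]) (rule sum.swap)
    finally show ?thesis .
  qed
  then have "(\<Sum>j<n. mtrace (apply_map \<Phi> m b R j))
    = (\<Sum>j<n. \<Sum>i<m. \<Sum>l\<in>L i j. \<Sum>r<b j. \<Sum>u<a i. \<Sum>v<a i. R i $$ (u, v) * (cnj (K i j l r v) * K i j l r u))"
    by simp
  also have "\<dots> = (\<Sum>i<m. \<Sum>j<n. \<Sum>l\<in>L i j. \<Sum>r<b j. \<Sum>u<a i. \<Sum>v<a i. R i $$ (u, v) * (cnj (K i j l r v) * K i j l r u))"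
    by (rule sum.swap)
  also have "\<dots> = (\<Sum>i<m. \<Sum>u<a i. \<Sum>v<a i. \<Sum>j<n. \<Sum>l\<in>L i j. \<Sum>r<b j. R i $$ (u, v) * (cnj (K i j l r v) * K i j l r u))"
    by (rule sum.cong[OF refl], rule trans[OF sum_swap_3], rule sum.cong[OF refl], rule sum_swap_3)
  finally show ?thesis by (simp only: sum_distrib_left)
qed

text \<open>Testing trace preservation on the matrix unit at (v,u) in a single block reads off the
  entry (u,v) of the sum of adjoint K times K.\<close>

lemma kraus_tp_of_channel:
  assumes kf: "kraus_family a m b n L K \<Phi>" and ch: "is_channel a m b n \<Phi>"
  shows "kraus_tp a m b n L K"
  unfolding kraus_tp_def
proof (intro allI impI)
  fix i u v assume i: "i < m" and uv: "u < a i" "v < a i"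
  define R where "R i' = (if i' = i then mat_unit (a i) v u else 0\<^sub>m (a i') (a i'))" for i'
  define t where "t i v u = (\<Sum>j<n. \<Sum>l\<in>L i j. \<Sum>r<b j. cnj (K i j l r v) * K i j l r u)" for i v u
  have R: "in_sum a m R" by (auto simp: in_sum_def R_def)
  have "(\<Sum>i'<m. mtrace (R i')) = (\<Sum>i'<m. \<Sum>u'<a i'. \<Sum>v'<a i'. R i' $$ (u', v') * t i' v' u')"
    using kraus_trace[OF kf R] ch R unfolding is_channel_def t_def by simp
  also have "\<dots> = (\<Sum>i'<m. if i' = i then t i u v else 0)"
  proof (intro sum.cong refl)
    fix i'
    show "(\<Sum>u'<a i'. \<Sum>v'<a i'. R i' $$ (u', v') * t i' v' u') = (if i' = i then t i u v else 0)"
    proof (cases "i' = i")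
      case True
      have "(\<Sum>u'<a i. \<Sum>v'<a i. R i $$ (u', v') * t i v' u')
        = (\<Sum>u'<a i. \<Sum>v'<a i. (if v = u' \<and> u = v' then 1 else 0) * t i v' u')"
        by (intro sum.cong refl) (auto simp: R_def)
      then show ?thesis using True sum_delta2_mult[of v "a i" u "a i" "\<lambda>u' v'. t i v' u'"] uv by simp
    next
      case False
      then show ?thesis by (simp add: R_def)
    qed
  qed
  also have "\<dots> = t i u v" using i by simp
  finally have "t i u v = (\<Sum>i'<m. mtrace (R i'))" by (rule sym)
  also have "\<dots> = (\<Sum>i'<m. if i' = i then mtrace (R i) else 0)"
    by (intro sum.cong refl) (auto simp: R_def mtrace_def)
  also have "\<dots> = mtrace (R i)" using i by simp
  also have "\<dots> = (\<Sum>x<a i. if x = v \<and> x = u then 1 else 0)"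
    by (simp add: mtrace_def R_def)
  also have "\<dots> = (\<Sum>x<a i. if x = v then (if u = v then 1 else 0) else 0)"
    by (intro sum.cong refl) auto
  also have "\<dots> = (if u = v then 1 else 0)" using uv by simp
  finally show "(\<Sum>j<n. \<Sum>l\<in>L i j. \<Sum>r<b j. cnj (K i j l r u) * K i j l r v) = (if u = v then 1 else 0)"
    unfolding t_def .
qed

text \<open>Moves the Kraus operators from the operator \<open>R\<close> onto the vectors
  \<open>f\<close> and \<open>g\<close>; \<open>p\<close> and \<open>q\<close> are ancilla indices,
  on which \<open>K\<close> and \<open>K'\<close> do not act.\<close>

lemma sum_sandwich:
  fixes f :: "'r \<Rightarrow> 'p \<Rightarrow> complex"
  shows "(\<Sum>r\<in>B. \<Sum>p\<in>P. \<Sum>s\<in>S. \<Sum>q\<in>Q. f r p * (\<Sum>u\<in>A. \<Sum>v\<in>A'. K r u * R u p v q * K' s v) * g s q)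
    = (\<Sum>u\<in>A. \<Sum>p\<in>P. \<Sum>v\<in>A'. \<Sum>q\<in>Q. (\<Sum>r\<in>B. f r p * K r u) * R u p v q * (\<Sum>s\<in>S. K' s v * g s q))"
  (is "?l = ?r")
proof -
  let ?h = "\<lambda>r p s q u v. f r p * (K r u * R u p v q * K' s v) * g s q"
  have "?l = (\<Sum>r\<in>B. \<Sum>p\<in>P. \<Sum>s\<in>S. \<Sum>q\<in>Q. \<Sum>u\<in>A. \<Sum>v\<in>A'. ?h r p s q u v)"
    by (simp only: sum_distrib_left sum_distrib_right)
  also have "\<dots> = (\<Sum>p\<in>P. \<Sum>s\<in>S. \<Sum>q\<in>Q. \<Sum>u\<in>A. \<Sum>v\<in>A'. \<Sum>r\<in>B. ?h r p s q u v)"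
    by (simp only: sum.swap[of _ _ B])
  also have "\<dots> = (\<Sum>p\<in>P. \<Sum>q\<in>Q. \<Sum>u\<in>A. \<Sum>v\<in>A'. \<Sum>r\<in>B. \<Sum>s\<in>S. ?h r p s q u v)"
    by (simp only: sum.swap[of _ _ S])
  also have "\<dots> = (\<Sum>q\<in>Q. \<Sum>u\<in>A. \<Sum>p\<in>P. \<Sum>v\<in>A'. \<Sum>r\<in>B. \<Sum>s\<in>S. ?h r p s q u v)"
    by (subst sum.swap, intro sum.cong refl, subst sum.swap, rule refl)
  also have "\<dots> = (\<Sum>u\<in>A. \<Sum>p\<in>P. \<Sum>v\<in>A'. \<Sum>q\<in>Q. \<Sum>r\<in>B. \<Sum>s\<in>S. ?h r p s q u v)"
    by (rule sum_swap_3[symmetric])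
  also have "\<dots> = (\<Sum>u\<in>A. \<Sum>p\<in>P. \<Sum>v\<in>A'. \<Sum>q\<in>Q. \<Sum>s\<in>S. \<Sum>r\<in>B. ?h r p s q u v)"
    by (simp only: sum.swap[of _ _ B])
  also have "\<dots> = ?r"
    by (simp only: sum_distrib_left sum_distrib_right mult.assoc)
  finally show ?thesis .
qed

lemma is_channel_of_kraus:
  fixes L :: "nat \<Rightarrow> nat \<Rightarrow> 'l set"
  assumes kf: "kraus_family a m b n L K \<Phi>" and tp: "kraus_tp a m b n L K"
  shows "is_channel a m b n \<Phi>"
  unfolding is_channel_def
proof (intro conjI allI impI ballI)
  fix i j and A B :: "complex mat" and c :: complex
  assume ij: "i < m" "j < n" and AB: "A \<in> carrier_mat (a i) (a i)" "B \<in> carrier_mat (a i) (a i)"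
  have c: "\<Phi> i j R \<in> carrier_mat (b j) (b j)" if "R \<in> carrier_mat (a i) (a i)" for R
    using kf ij that unfolding kraus_family_def by simp
  show "\<Phi> i j A \<in> carrier_mat (b j) (b j)" using c AB by simp
  show "\<Phi> i j (c \<cdot>\<^sub>m A + B) = c \<cdot>\<^sub>m \<Phi> i j A + \<Phi> i j B" (is "?l = ?r")
  proof (rule eq_matI)
    fix r s assume "r < dim_row ?r" "s < dim_col ?r"
    then have rs: "r < b j" "s < b j" using c[OF AB(1)] c[OF AB(2)] by auto
    have "?l $$ (r, s) = (\<Sum>l\<in>L i j. \<Sum>u<a i. \<Sum>v<a i. c * (K i j l r u * A $$ (u, v) * cnj (K i j l s v))
        + K i j l r u * B $$ (u, v) * cnj (K i j l s v))"
      using ij AB rs by (subst kraus_family_index[OF kf]) (auto intro!: sum.cong simp: algebra_simps)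
    also have "\<dots> = c * \<Phi> i j A $$ (r, s) + \<Phi> i j B $$ (r, s)"
      using ij AB rs by (simp add: kraus_family_index[OF kf] sum.distrib sum_distrib_left)
    also have "\<dots> = ?r $$ (r, s)" using c[OF AB(1)] c[OF AB(2)] rs by auto
    finally show "?l $$ (r, s) = ?r $$ (r, s)" .
  qed (use c[of "c \<cdot>\<^sub>m A + B"] c[OF AB(1)] c[OF AB(2)] AB in auto)
next
  fix k R j assume psd: "\<forall>i<m. psd (a i * k) (R i)" and j: "j < n"
  let ?Z = "apply_map_id \<Phi> a m b k R j"
  show "psd (b j * k) ?Z"
    unfolding psd_iff
  proof (intro conjI allI)
    show "?Z \<in> carrier_mat (b j * k) (b j * k)" by (simp add: apply_map_id_def apply_map_def)
    fix v :: "nat \<Rightarrow> complex"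
    \<comment> \<open>This is the adjoint of K \<otimes> 1 applied to \<open>v\<close>. The form of
      the output at \<open>v\<close> is the sum over \<open>i\<close> and \<open>l\<close> of the
      forms of \<open>R i\<close> at these vectors, which gives complete positivity.\<close>
    define \<xi> where "\<xi> i l z = (\<Sum>s<b j. cnj (K i j l s (z div k)) * v (s * k + z mod k))" for i l z
    have "(\<Sum>x<b j * k. \<Sum>y<b j * k. cnj (v x) * ?Z $$ (x, y) * v y)
      = (\<Sum>r<b j. \<Sum>p<k. \<Sum>s<b j. \<Sum>q<k. \<Sum>i<m. \<Sum>l\<in>L i j. cnj (v (r * k + p)) *
        (\<Sum>u<a i. \<Sum>u'<a i. K i j l r u * R i $$ (u * k + p, u' * k + q) * cnj (K i j l s u')) * v (s * k + q))"
      unfolding sum_lessThan_mult using j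
      by (intro sum.cong refl) (simp add: apply_map_id_index kraus_family_index[OF kf]
        sum_distrib_left[of "cnj _"] sum_distrib_right[of _ _ "v _"] blk_def)
    also have "\<dots> = (\<Sum>i<m. \<Sum>l\<in>L i j. \<Sum>r<b j. \<Sum>p<k. \<Sum>s<b j. \<Sum>q<k. cnj (v (r * k + p)) *
        (\<Sum>u<a i. \<Sum>u'<a i. K i j l r u * R i $$ (u * k + p, u' * k + q) * cnj (K i j l s u')) * v (s * k + q))"
    proof -
      have "(\<Sum>r\<in>A. \<Sum>p\<in>B. \<Sum>s\<in>C. \<Sum>q\<in>D. \<Sum>i\<in>I. \<Sum>l\<in>J i. f r p s q i l) =
         (\<Sum>i\<in>I. \<Sum>l\<in>J i. \<Sum>r\<in>A. \<Sum>p\<in>B. \<Sum>s\<in>C. \<Sum>q\<in>D. f r p s q i l)"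
        for A B C D :: "nat set" and I :: "nat set" and J :: "nat \<Rightarrow> 'l set" and f :: "nat \<Rightarrow> nat \<Rightarrow> nat \<Rightarrow> nat \<Rightarrow> nat \<Rightarrow> 'l \<Rightarrow> complex"
        by (simp only: sum.swap[of _ I]) (simp only: sum.swap[of _ "J _"])
      then show ?thesis .
    qed
    also have "\<dots> = (\<Sum>i<m. \<Sum>l\<in>L i j. \<Sum>x<a i * k. \<Sum>y<a i * k. cnj (\<xi> i l x) * R i $$ (x, y) * \<xi> i l y)"
      unfolding sum_sandwich sum_lessThan_mult
      by (intro sum.cong refl) (simp add: \<xi>_def mult.commute)
    finally have e: "(\<Sum>x<b j * k. \<Sum>y<b j * k. cnj (v x) * ?Z $$ (x, y) * v y)
      = (\<Sum>i<m. \<Sum>l\<in>L i j. \<Sum>x<a i * k. \<Sum>y<a i * k. cnj (\<xi> i l x) * R i $$ (x, y) * \<xi> i l y)" .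
    define \<rho> where "\<rho> i l = Re (\<Sum>x<a i * k. \<Sum>y<a i * k. cnj (\<xi> i l x) * R i $$ (x, y) * \<xi> i l y)" for i l
    have \<rho>: "\<rho> i l \<ge> 0"
      "(\<Sum>x<a i * k. \<Sum>y<a i * k. cnj (\<xi> i l x) * R i $$ (x, y) * \<xi> i l y) = complex_of_real (\<rho> i l)"
      if "i < m" for i l
    proof -
      have "psd (a i * k) (R i)" using psd that by simp
      then obtain r :: real where "r \<ge> 0"
        "(\<Sum>x<a i * k. \<Sum>y<a i * k. cnj (\<xi> i l x) * R i $$ (x, y) * \<xi> i l y) = complex_of_real r"
        unfolding psd_iff by blast
      then show "\<rho> i l \<ge> 0"
        "(\<Sum>x<a i * k. \<Sum>y<a i * k. cnj (\<xi> i l x) * R i $$ (x, y) * \<xi> i l y) = complex_of_real (\<rho> i l)"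
        by (simp_all add: \<rho>_def)
    qed
    show "\<exists>r::real. r \<ge> 0 \<and> (\<Sum>x<b j * k. \<Sum>y<b j * k. cnj (v x) * ?Z $$ (x, y) * v y) = complex_of_real r"
      unfolding e by (intro exI[of _ "\<Sum>i<m. \<Sum>l\<in>L i j. \<rho> i l"]) (auto simp: \<rho> intro!: sum_nonneg)
  qed
next
  fix R assume R: "in_sum a m R"
  have "(\<Sum>j<n. mtrace (apply_map \<Phi> m b R j))
    = (\<Sum>i<m. \<Sum>u<a i. \<Sum>v<a i. R i $$ (u, v) * (if v = u then 1 else 0))"
    unfolding kraus_trace[OF kf R] using tp unfolding kraus_tp_def by simp
  also have "\<dots> = (\<Sum>i<m. mtrace (R i))"
    using R by (intro sum.cong refl) (auto simp: sum_delta_mult mtrace_def in_sum_def)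
  finally show "(\<Sum>j<n. mtrace (apply_map \<Phi> m b R j)) = (\<Sum>i<m. mtrace (R i))" .
qed

section \<open>Composition through a pure state\<close>

text \<open>The operator S (K \<otimes> 1)(1 \<otimes> |w>) from X to X': \<open>K\<close> consumes
  the first leg of the vector \<open>w\<close>, and \<open>S\<close> consumes the second together
  with the output of \<open>K\<close>.\<close>

definition link :: "nat \<Rightarrow> nat \<Rightarrow> (nat \<Rightarrow> nat \<Rightarrow> complex) \<Rightarrow> (nat \<Rightarrow> nat \<Rightarrow> complex)
    \<Rightarrow> (nat \<Rightarrow> nat \<Rightarrow> complex) \<Rightarrow> nat \<Rightarrow> nat \<Rightarrow> complex" where
  "link b d w S K x u = (\<Sum>y<b. \<Sum>p<d. S x (y * d + p) * (\<Sum>h<d. K y (u * d + h) * w h p))"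

lemma sum_sandwich_simple:
  fixes f :: "'z \<Rightarrow> complex"
  shows "(\<Sum>z\<in>B. \<Sum>z'\<in>B'. f z * (\<Sum>u\<in>A. \<Sum>v\<in>A'. K z u * R u v * K' z' v) * g z')
    = (\<Sum>u\<in>A. \<Sum>v\<in>A'. (\<Sum>z\<in>B. f z * K z u) * R u v * (\<Sum>z'\<in>B'. K' z' v * g z'))"
  using sum_sandwich[of "\<lambda>z (_::unit). f z" K "\<lambda>u _ v _. R u v" K' A' A "\<lambda>z _. g z" "{()}" B' "{()}" B]
  by simp

text \<open>Kronecker ordering is strictly associative, so the grouping (X \<otimes> H) \<otimes> H
  seen by the channel and the grouping X \<otimes> (H \<otimes> H) seen by \<open>kron R W\<close>
  give the same index.\<close>

lemma kron_pure_index: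
  assumes W: "W \<in> carrier_mat (d * d) (d * d)" and R: "R \<in> carrier_mat a a"
    and "u < a" "v < a" "h < d" "h' < d" "p < d" "p' < d"
  shows "kron R W $$ ((u * d + h) * d + p, (v * d + h') * d + p') = R $$ (u, v) * W $$ (h * d + p, h' * d + p')"
proof -
  have e: "(u * d + h) * d + p = u * (d * d) + (h * d + p)" "(v * d + h') * d + p' = v * (d * d) + (h' * d + p')"
    by (simp_all add: algebra_simps)
  have l: "h * d + p < d * d" "h' * d + p' < d * d" using assms by (simp_all add: index_less_mult)
  then have "u * (d * d) + (h * d + p) < a * (d * d)" "v * (d * d) + (h' * d + p') < a * (d * d)"
    using assms index_less_mult by blast+
  moreover have "(c * D + t) div D = c" "(c * D + t) mod D = t" if "t < D" for c D t :: nat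
    using that by simp_all
  ultimately show ?thesis unfolding e kron_def using W R l by (simp only: index_mat case_prod_conv carrier_matD)
qed

text \<open>The assumptions are symmetric in the two channels, so both inversion equations are
  instances: one with M before N and the state itself, the other with N before M and the swapped
  state.\<close>

context
  fixes dX dY :: "nat \<Rightarrow> nat" and m n d :: nat
    and L :: "nat \<Rightarrow> nat \<Rightarrow> 'k set" and L' :: "nat \<Rightarrow> nat \<Rightarrow> 'l set"
    and K :: "nat \<Rightarrow> nat \<Rightarrow> 'k \<Rightarrow> nat \<Rightarrow> nat \<Rightarrow> complex" and S :: "nat \<Rightarrow> nat \<Rightarrow> 'l \<Rightarrow> nat \<Rightarrow> nat \<Rightarrow> complex"
    and M N :: "nat \<Rightarrow> nat \<Rightarrow> complex mat \<Rightarrow> complex mat"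
    and W :: "complex mat" and w :: "nat \<Rightarrow> nat \<Rightarrow> complex"
  assumes d: "d > 0"
    and M: "kraus_family (\<lambda>i. dX i * d) m dY n L K M"
    and N: "kraus_family (\<lambda>j. dY j * d) n dX m L' S N"
    and W: "W \<in> carrier_mat (d * d) (d * d)"
    and W_index: "\<And>h p h' p'. h < d \<Longrightarrow> p < d \<Longrightarrow> h' < d \<Longrightarrow> p' < d \<Longrightarrow>
      W $$ (h * d + p, h' * d + p') = w h p * cnj (w h' p')"
begin

abbreviation composite :: "(nat \<Rightarrow> complex mat) \<Rightarrow> nat \<Rightarrow> complex mat" where
  "composite \<rho> \<equiv> apply_map N n dX (apply_map_id M (\<lambda>i'. dX i' * d) m dY d (\<lambda>i'. kron (\<rho> i') W))"

abbreviation lnk where "lnk i i' j k l x u \<equiv> link (dY j) d w (S j i l) (K i' j k) x u"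

text \<open>A pure state contributes a single vector, so each Kraus operator of M yields just one
  operator (K \<otimes> 1)(1 \<otimes> |w>) into Y \<otimes> H.\<close>

lemma apply_map_id_pure_index:
  assumes \<rho>: "in_sum dX m \<rho>" and j: "j < n" and z: "z < dY j * d" "z' < dY j * d"
  shows "apply_map_id M (\<lambda>i'. dX i' * d) m dY d (\<lambda>i'. kron (\<rho> i') W) j $$ (z, z')
    = (\<Sum>i<m. \<Sum>k\<in>L i j. \<Sum>u<dX i. \<Sum>v<dX i.
        (\<Sum>h<d. K i j k (z div d) (u * d + h) * w h (z mod d)) * \<rho> i $$ (u, v) *
        cnj (\<Sum>h<d. K i j k (z' div d) (v * d + h) * w h (z' mod d)))"
proof -
  define y p y' p' where "y = z div d" "p = z mod d" "y' = z' div d" "p' = z' mod d"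
  have z_eq: "z = y * d + p" "z' = y' * d + p'" by (simp_all add: y_p_y'_p'_def)
  have r: "y < dY j" "y' < dY j" "p < d" "p' < d"
    using z d by (simp_all add: y_p_y'_p'_def less_mult_imp_div_less)
  have "M i j (blk (dX i * d) d (kron (\<rho> i) W) p p') $$ (y, y')
    = (\<Sum>k\<in>L i j. \<Sum>u<dX i. \<Sum>v<dX i.
        (\<Sum>h<d. K i j k y (u * d + h) * w h p) * \<rho> i $$ (u, v) * cnj (\<Sum>h<d. K i j k y' (v * d + h) * w h p'))"
    if i: "i < m" for i
  proof -
    have \<rho>i: "\<rho> i \<in> carrier_mat (dX i) (dX i)" using \<rho> i by (simp add: in_sum_def)
    have "M i j (blk (dX i * d) d (kron (\<rho> i) W) p p') $$ (y, y')
      = (\<Sum>k\<in>L i j. \<Sum>u<dX i. \<Sum>h<d. \<Sum>v<dX i. \<Sum>h'<d. K i j k y (u * d + h) *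
          kron (\<rho> i) W $$ ((u * d + h) * d + p, (v * d + h') * d + p') * cnj (K i j k y' (v * d + h')))"
      using i j r \<rho>i by (simp add: kraus_family_index[OF M] sum_lessThan_mult blk_def index_less_mult)
    also have "\<dots> = (\<Sum>k\<in>L i j. \<Sum>u<dX i. \<Sum>h<d. \<Sum>v<dX i. \<Sum>h'<d.
          (K i j k y (u * d + h) * w h p) * \<rho> i $$ (u, v) * cnj (K i j k y' (v * d + h') * w h' p'))"
      using r \<rho>i by (intro sum.cong refl) (simp add: kron_pure_index[OF W \<rho>i] W_index)
    also have "\<dots> = (\<Sum>k\<in>L i j. \<Sum>u<dX i. \<Sum>v<dX i. \<Sum>h<d. \<Sum>h'<d.
          (K i j k y (u * d + h) * w h p) * \<rho> i $$ (u, v) * cnj (K i j k y' (v * d + h') * w h' p'))"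
      by (rule sum.cong[OF refl], rule sum.cong[OF refl], rule sum.swap)
    also have "\<dots> = (\<Sum>k\<in>L i j. \<Sum>u<dX i. \<Sum>v<dX i.
        (\<Sum>h<d. K i j k y (u * d + h) * w h p) * \<rho> i $$ (u, v) * cnj (\<Sum>h<d. K i j k y' (v * d + h) * w h p'))"
      by (simp only: cnj_sum sum_product sum_distrib_right) (simp only: sum_distrib_left)
    finally show ?thesis .
  qed
  then show ?thesis
    unfolding z_eq using r by (subst apply_map_id_index) simp_all
qed

lemma composite_index:
  assumes \<rho>: "in_sum dX m \<rho>" and i: "i < m" and x: "x < dX i" "x' < dX i"
  shows "composite \<rho> i $$ (x, x') = (\<Sum>j<n. \<Sum>l\<in>L' j i. \<Sum>i'<m. \<Sum>k\<in>L i' j.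
    \<Sum>u<dX i'. \<Sum>v<dX i'. lnk i i' j k l x u * \<rho> i' $$ (u, v) * cnj (lnk i i' j k l x' v))"
proof -
  define Z where "Z = apply_map_id M (\<lambda>i'. dX i' * d) m dY d (\<lambda>i'. kron (\<rho> i') W)"
  define A where "A i j k z u = (\<Sum>h<d. K i j k (z div d) (u * d + h) * w h (z mod d))" for i j k z u
  have Z: "Z j \<in> carrier_mat (dY j * d) (dY j * d)" for j
    by (simp add: Z_def apply_map_id_def apply_map_def)
  have lnk: "lnk i i' j k l x u = (\<Sum>z<dY j * d. S j i l x z * A i' j k z u)" for i' j k l x u
    unfolding link_def A_def sum_lessThan_mult by simp
  have "composite \<rho> i $$ (x, x') = (\<Sum>j<n. N j i (Z j) $$ (x, x'))"
    using x by (simp add: apply_map_def Z_def)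
  also have "\<dots> = (\<Sum>j<n. \<Sum>l\<in>L' j i. \<Sum>z<dY j * d. \<Sum>z'<dY j * d. S j i l x z *
      (\<Sum>i'<m. \<Sum>k\<in>L i' j. \<Sum>u<dX i'. \<Sum>v<dX i'. A i' j k z u * \<rho> i' $$ (u, v) * cnj (A i' j k z' v)) *
      cnj (S j i l x' z'))"
    using i x Z by (intro sum.cong refl)
      (simp add: kraus_family_index[OF N] apply_map_id_pure_index[OF \<rho>] Z_def A_def)
  also have "\<dots> = (\<Sum>j<n. \<Sum>l\<in>L' j i. \<Sum>i'<m. \<Sum>k\<in>L i' j. \<Sum>z<dY j * d. \<Sum>z'<dY j * d. S j i l x z *
      (\<Sum>u<dX i'. \<Sum>v<dX i'. A i' j k z u * \<rho> i' $$ (u, v) * cnj (A i' j k z' v)) *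
      cnj (S j i l x' z'))"
  proof (rule sum.cong[OF refl], rule sum.cong[OF refl])
    fix j l
    have sw: "(\<Sum>z\<in>B. \<Sum>z'\<in>B. f z * (\<Sum>i'\<in>I. \<Sum>k\<in>J i'. F z z' i' k) * g z')
      = (\<Sum>i'\<in>I. \<Sum>k\<in>J i'. \<Sum>z\<in>B. \<Sum>z'\<in>B. f z * F z z' i' k * g z')"
      for B I :: "nat set" and J :: "nat \<Rightarrow> 'k set" and f g :: "nat \<Rightarrow> complex" and F
      by (simp only: sum_distrib_left sum_distrib_right sum.swap[of _ I]) (simp only: sum.swap[of _ "J _"])
    show "(\<Sum>z<dY j * d. \<Sum>z'<dY j * d. S j i l x z *
      (\<Sum>i'<m. \<Sum>k\<in>L i' j. \<Sum>u<dX i'. \<Sum>v<dX i'. A i' j k z u * \<rho> i' $$ (u, v) * cnj (A i' j k z' v)) *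
      cnj (S j i l x' z')) = (\<Sum>i'<m. \<Sum>k\<in>L i' j. \<Sum>z<dY j * d. \<Sum>z'<dY j * d. S j i l x z *
      (\<Sum>u<dX i'. \<Sum>v<dX i'. A i' j k z u * \<rho> i' $$ (u, v) * cnj (A i' j k z' v)) *
      cnj (S j i l x' z'))"
      by (rule sw)
  qed
  also have "\<dots> = (\<Sum>j<n. \<Sum>l\<in>L' j i. \<Sum>i'<m. \<Sum>k\<in>L i' j.
    \<Sum>u<dX i'. \<Sum>v<dX i'. lnk i i' j k l x u * \<rho> i' $$ (u, v) * cnj (lnk i i' j k l x' v))"
    unfolding sum_sandwich_simple lnk by (simp add: mult.commute[of "cnj _" "cnj _"])
  finally show ?thesis .
qed

text \<open>Kraus operators that are multiples of the identity rescale \<rho> by the sum of their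
  squared moduli. Normalisation is requested for nonzero blocks only, since the scalars will be read
  off at column 0.\<close>

lemma composite_id_of_scalar:
  assumes sc: "\<And>i i' j k l x u. i < m \<Longrightarrow> i' < m \<Longrightarrow> j < n \<Longrightarrow> k \<in> L i' j \<Longrightarrow> l \<in> L' j i \<Longrightarrow> x < dX i \<Longrightarrow> u < dX i' \<Longrightarrow>
      lnk i i' j k l x u = (if i' = i \<and> u = x then \<kappa> i j k l else 0)"
    and norm: "\<And>i. i < m \<Longrightarrow> 0 < dX i \<Longrightarrow> (\<Sum>j<n. \<Sum>k\<in>L i j. \<Sum>l\<in>L' j i. \<kappa> i j k l * cnj (\<kappa> i j k l)) = 1"
    and \<rho>: "in_sum dX m \<rho>" and i: "i < m"
  shows "composite \<rho> i = \<rho> i"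
proof (rule eq_matI)
  have \<rho>i: "\<rho> i \<in> carrier_mat (dX i) (dX i)" using \<rho> i by (simp add: in_sum_def)
  show "dim_row (composite \<rho> i) = dim_row (\<rho> i)" "dim_col (composite \<rho> i) = dim_col (\<rho> i)"
    using \<rho>i by (auto simp: apply_map_def)
  fix x x' assume "x < dim_row (\<rho> i)" "x' < dim_col (\<rho> i)"
  then have x: "x < dX i" "x' < dX i" using \<rho>i by auto
  have "composite \<rho> i $$ (x, x') = (\<Sum>j<n. \<Sum>l\<in>L' j i. \<Sum>i'<m. if i' = i then
      (\<Sum>k\<in>L i j. \<kappa> i j k l * cnj (\<kappa> i j k l) * \<rho> i $$ (x, x')) else 0)"
    unfolding composite_index[OF \<rho> i x]
  proof (intro sum.cong refl)
    fix j l i' assume a: "j \<in> {..<n}" "l \<in> L' j i" "i' \<in> {..<m}"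
    show "(\<Sum>k\<in>L i' j. \<Sum>u<dX i'. \<Sum>v<dX i'. lnk i i' j k l x u * \<rho> i' $$ (u, v) * cnj (lnk i i' j k l x' v))
      = (if i' = i then (\<Sum>k\<in>L i j. \<kappa> i j k l * cnj (\<kappa> i j k l) * \<rho> i $$ (x, x')) else 0)"
    proof (cases "i' = i")
      case False
      then show ?thesis using a i x by (simp add: sc)
    next
      case True
      have "(\<Sum>u<dX i. \<Sum>v<dX i. lnk i i j k l x u * \<rho> i $$ (u, v) * cnj (lnk i i j k l x' v))
        = \<kappa> i j k l * cnj (\<kappa> i j k l) * \<rho> i $$ (x, x')" if "k \<in> L i j" for k
      proof -
        have "(\<Sum>u<dX i. \<Sum>v<dX i. lnk i i j k l x u * \<rho> i $$ (u, v) * cnj (lnk i i j k l x' v))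
          = (\<Sum>u<dX i. \<Sum>v<dX i. (if x = u \<and> x' = v then 1 else 0) * (\<kappa> i j k l * cnj (\<kappa> i j k l) * \<rho> i $$ (u, v)))"
          using a i x that by (intro sum.cong refl) (auto simp: sc)
        then show ?thesis using x by (simp only: sum_delta2_mult)
      qed
      then show ?thesis using True by simp
    qed
  qed
  also have "\<dots> = (\<Sum>j<n. \<Sum>l\<in>L' j i. \<Sum>k\<in>L i j. \<kappa> i j k l * cnj (\<kappa> i j k l) * \<rho> i $$ (x, x'))"
    using i by simp
  also have "\<dots> = (\<Sum>j<n. \<Sum>k\<in>L i j. \<Sum>l\<in>L' j i. \<kappa> i j k l * cnj (\<kappa> i j k l) * \<rho> i $$ (x, x'))"
    by (rule sum.cong[OF refl]) (rule sum.swap)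
  also have "\<dots> = \<rho> i $$ (x, x')"
    using norm[OF i] x by (simp add: sum_distrib_right[symmetric])
  finally show "composite \<rho> i $$ (x, x') = \<rho> i $$ (x, x')" .
qed

lemma sum_norm_zero:
  fixes z :: "nat \<Rightarrow> 'l \<Rightarrow> 'k \<Rightarrow> complex"
  assumes "\<And>j. j < n \<Longrightarrow> finite (A j)" "\<And>j. j < n \<Longrightarrow> finite (B j)"
    and "(\<Sum>j<n. \<Sum>l\<in>A j. \<Sum>k\<in>B j. z j l k * cnj (z j l k)) = 0"
    and "j < n" "l \<in> A j" "k \<in> B j"
  shows "z j l k = 0"
proof -
  have "complex_of_real (\<Sum>j<n. \<Sum>l\<in>A j. \<Sum>k\<in>B j. (cmod (z j l k))\<^sup>2) = 0"
    using assms(3) by (simp only: of_real_sum complex_norm_square)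
  then have "(\<Sum>j<n. \<Sum>l\<in>A j. \<Sum>k\<in>B j. (cmod (z j l k))\<^sup>2) = 0" by (simp only: of_real_eq_0_iff)
  then have "(\<Sum>l\<in>A j. \<Sum>k\<in>B j. (cmod (z j l k))\<^sup>2) = 0"
    using assms by (subst (asm) sum_nonneg_eq_0_iff) (auto intro!: sum_nonneg)
  then have "(\<Sum>k\<in>B j. (cmod (z j l k))\<^sup>2) = 0"
    using assms by (subst (asm) sum_nonneg_eq_0_iff) (auto intro!: sum_nonneg)
  then show ?thesis
    using assms by (subst (asm) sum_nonneg_eq_0_iff) auto
qed

text \<open>Matrix units as inputs determine all inner products, over the Kraus index, of the matrix
  entries of the \<open>lnk\<close>. Off-diagonal entries, and all entries between different blocks,
  have norm 0, while the diagonal ones are unit vectors with mutual inner product 1, hence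
  equal.\<close>

lemma scalar_of_composite_id:
  assumes id: "\<And>\<rho> i. in_sum dX m \<rho> \<Longrightarrow> i < m \<Longrightarrow> composite \<rho> i = \<rho> i"
    and fin: "\<And>i j. i < m \<Longrightarrow> j < n \<Longrightarrow> finite (L i j)" "\<And>i j. i < m \<Longrightarrow> j < n \<Longrightarrow> finite (L' j i)"
    and i: "i < m" "i' < m" and jkl: "j < n" "k \<in> L i' j" "l \<in> L' j i" and xu: "x < dX i" "u < dX i'"
  shows "lnk i i' j k l x u = (if i' = i \<and> u = x then lnk i i j k l 0 0 else 0)"
proof -
  have gram: "(\<Sum>j<n. \<Sum>l\<in>L' j i. \<Sum>k\<in>L i' j. lnk i i' j k l x u * cnj (lnk i i' j k l x' v))
    = (if i' = i \<and> u = x \<and> v = x' then 1 else 0)"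
    if x: "x < dX i" "x' < dX i" and uv: "u < dX i'" "v < dX i'" for x x' u v
  proof -
    define \<rho> where "\<rho> a = (if a = i' then mat_unit (dX i') u v else 0\<^sub>m (dX a) (dX a))" for a
    have \<rho>: "in_sum dX m \<rho>" by (auto simp: \<rho>_def in_sum_def)
    have "\<rho> i $$ (x, x') = (\<Sum>j<n. \<Sum>l\<in>L' j i. \<Sum>a<m. \<Sum>k\<in>L a j.
      \<Sum>u<dX a. \<Sum>v<dX a. lnk i a j k l x u * \<rho> a $$ (u, v) * cnj (lnk i a j k l x' v))"
      using id[OF \<rho> i(1)] composite_index[OF \<rho> i(1) x] by simp
    also have "\<dots> = (\<Sum>j<n. \<Sum>l\<in>L' j i. \<Sum>a<m. if a = i' then
        (\<Sum>k\<in>L i' j. lnk i i' j k l x u * cnj (lnk i i' j k l x' v)) else 0)"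
    proof (intro sum.cong refl)
      fix j l a
      show "(\<Sum>k\<in>L a j. \<Sum>u<dX a. \<Sum>v<dX a. lnk i a j k l x u * \<rho> a $$ (u, v) * cnj (lnk i a j k l x' v))
        = (if a = i' then (\<Sum>k\<in>L i' j. lnk i i' j k l x u * cnj (lnk i i' j k l x' v)) else 0)"
      proof (cases "a = i'")
        case False
        then show ?thesis by (simp add: \<rho>_def)
      next
        case True
        have "(\<Sum>u'<dX i'. \<Sum>v'<dX i'. lnk i i' j k l x u' * \<rho> i' $$ (u', v') * cnj (lnk i i' j k l x' v'))
          = (\<Sum>u'<dX i'. \<Sum>v'<dX i'. (if u = u' \<and> v = v' then 1 else 0) * (lnk i i' j k l x u' * cnj (lnk i i' j k l x' v')))" for k
          by (intro sum.cong refl) (auto simp: \<rho>_def)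
        then show ?thesis using True uv by (simp only: sum_delta2_mult simp_thms if_True)
      qed
    qed
    also have "\<dots> = (\<Sum>j<n. \<Sum>l\<in>L' j i. \<Sum>k\<in>L i' j. lnk i i' j k l x u * cnj (lnk i i' j k l x' v))"
      using i by simp
    finally have "(\<Sum>j<n. \<Sum>l\<in>L' j i. \<Sum>k\<in>L i' j. lnk i i' j k l x u * cnj (lnk i i' j k l x' v)) = \<rho> i $$ (x, x')"
      by (rule sym)
    also have "\<dots> = (if i' = i \<and> u = x \<and> v = x' then 1 else 0)"
      using x by (cases "i' = i") (auto simp: \<rho>_def)
    finally show ?thesis .
  qed
  show ?thesis
  proof (cases "i' = i \<and> u = x")
    case False
    then have "(\<Sum>j<n. \<Sum>l\<in>L' j i. \<Sum>k\<in>L i' j. lnk i i' j k l x u * cnj (lnk i i' j k l x u)) = 0"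
      using gram[OF xu(1) xu(1) xu(2) xu(2)] by auto
    then have "lnk i i' j k l x u = 0"
      using i jkl fin by (intro sum_norm_zero[of "\<lambda>j. L' j i" "L i'" "\<lambda>j l k. lnk i i' j k l x u"]) auto
    then show ?thesis using False by auto
  next
    case True
    then have e: "i' = i" "u = x" and X: "0 < dX i" using xu by auto
    note g = gram[unfolded e]
    \<comment> \<open>The squared distance of the diagonal entries at \<open>x\<close> and 0 expands
      to 1 - 1 - 1 + 1.\<close>
    have "(\<Sum>j<n. \<Sum>l\<in>L' j i. \<Sum>k\<in>L i j. (lnk i i j k l x x - lnk i i j k l 0 0) * cnj (lnk i i j k l x x - lnk i i j k l 0 0)) = 0"
      using g[OF xu(1) xu(1) xu(1) xu(1)] g[OF xu(1) X xu(1) X] g[OF X xu(1) X xu(1)] g[OF X X X X]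
      by (simp add: algebra_simps sum.distrib sum_subtractf)
    then have "lnk i i j k l x x - lnk i i j k l 0 0 = 0"
      using i jkl fin unfolding e
      by (intro sum_norm_zero[of "\<lambda>j. L' j i" "L i" "\<lambda>j l k. lnk i i j k l x x - lnk i i j k l 0 0"]) auto
    then show ?thesis using e by simp
  qed
qed

end

section \<open>Biunitarity\<close>

text \<open>What the argument keeps of M: for each \<open>i\<close>, the \<tau>_ij taken together
  over \<open>j\<close> form an isometry, and each dilation is minimal. The entangled state is
  absent, so one instance serves both states.\<close>

locale tp_kraus =
  fixes dX dY :: "nat \<Rightarrow> nat" and m n d :: nat and dE :: "nat \<Rightarrow> nat \<Rightarrow> nat"
    and T :: "nat \<Rightarrow> nat \<Rightarrow> nat \<Rightarrow> nat \<Rightarrow> nat \<Rightarrow> nat \<Rightarrow> complex"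
  assumes T_tp: "\<And>i x x' h h'. i < m \<Longrightarrow> x < dX i \<Longrightarrow> x' < dX i \<Longrightarrow> h < d \<Longrightarrow> h' < d \<Longrightarrow>
      (\<Sum>j<n. \<Sum>k<dE j i. \<Sum>y<dY j. cnj (T i j k y x h) * T i j k y x' h')
      = (if x = x' \<and> h = h' then 1 else 0)"
    and T_indep: "\<And>i j c. i < m \<Longrightarrow> j < n \<Longrightarrow>
      (\<And>y x h. y < dY j \<Longrightarrow> x < dX i \<Longrightarrow> h < d \<Longrightarrow> (\<Sum>k<dE j i. c k * T i j k y x h) = 0) \<Longrightarrow>
      \<forall>k<dE j i. c k = 0"
begin

text \<open>
  This is the matrix $\Lambda$. Evaluating at \<open>x = 0\<close> is harmless: \<open>dX i = 0\<close> forces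
  \<open>dE j i = 0\<close> by minimality.
\<close>
definition gram :: "nat \<Rightarrow> nat \<Rightarrow> nat \<Rightarrow> nat \<Rightarrow> complex" where
  "gram i j k' k = (\<Sum>y<dY j. \<Sum>h<d. cnj (T i j k' y 0 h) * T i j k y 0 h)"

text \<open>The conjuncts say: the isometry \<tau>_i is also a coisometry; the columns of the
  reshuffled T are orthogonal up to \<Lambda>; \<open>P\<close> is a Hermitian inverse of \<Lambda>;
  and those columns are complete, with \<open>P\<close> compensating for their Gram matrix.\<close>

definition biunitary :: "(nat \<Rightarrow> nat \<Rightarrow> nat \<Rightarrow> nat \<Rightarrow> complex) \<Rightarrow> bool" where
  "biunitary P \<longleftrightarrow>
    (\<forall>i<m. \<forall>j<n. \<forall>j'<n. \<forall>k<dE j i. \<forall>k'<dE j' i. \<forall>y<dY j. \<forall>y'<dY j'.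
      (\<Sum>x<dX i. \<Sum>h<d. T i j' k' y' x h * cnj (T i j k y x h))
        = (if j = j' \<and> y = y' then if k = k' then 1 else 0 else 0)) \<and>
    (\<forall>j<n. \<forall>i<m. \<forall>i'<m. \<forall>k<dE j i. \<forall>k'<dE j i'. \<forall>x<dX i. \<forall>x'<dX i'.
      (\<Sum>y<dY j. \<Sum>h<d. cnj (T i' j k' y x' h) * T i j k y x h)
        = (if i = i' \<and> x = x' then gram i j k' k else 0)) \<and>
    (\<forall>i<m. \<forall>j<n. \<forall>a<dE j i. \<forall>b<dE j i.
      (\<Sum>k<dE j i. P i j a k * gram i j k b) = (if a = b then 1 else 0) \<and>
      P i j a b = cnj (P i j b a)) \<and>
    (\<forall>j<n. \<forall>y<dY j. \<forall>y'<dY j. \<forall>h<d. \<forall>h'<d.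
      (\<Sum>i<m. \<Sum>k<dE j i. \<Sum>x<dX i. T i j k y x h * (\<Sum>k'<dE j i. P i j k k' * cnj (T i j k' y' x h')))
        = (if y = y' \<and> h = h' then 1 else 0))"

lemma dE_pos_imp_dX_pos:
  assumes "i < m" "j < n" "k < dE j i" shows "0 < dX i"
  using T_indep[OF assms(1,2), of "\<lambda>_. 1"] assms(3) by (cases "dX i") auto

end

section \<open>Necessity: an inverse forces biunitarity and the intertwiner\<close>

locale linked_kraus = tp_kraus +
  fixes L :: "nat \<Rightarrow> nat \<Rightarrow> 'l set"
    and S :: "nat \<Rightarrow> nat \<Rightarrow> 'l \<Rightarrow> nat \<Rightarrow> nat \<Rightarrow> nat \<Rightarrow> complex"
    and \<kappa> \<mu> :: "nat \<Rightarrow> nat \<Rightarrow> nat \<Rightarrow> 'l \<Rightarrow> complex"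
    and Q Qi :: "nat \<Rightarrow> nat \<Rightarrow> complex"
  assumes S_T: "\<And>i i' j k l x x'. i < m \<Longrightarrow> i' < m \<Longrightarrow> j < n \<Longrightarrow> k < dE j i \<Longrightarrow> l \<in> L j i' \<Longrightarrow>
      x < dX i \<Longrightarrow> x' < dX i' \<Longrightarrow>
      (\<Sum>y<dY j. \<Sum>h<d. S j i' l x' y h * T i j k y x h) = (if i = i' \<and> x = x' then \<kappa> i j k l else 0)"
    and T_S: "\<And>i j j' k l y y'. i < m \<Longrightarrow> j < n \<Longrightarrow> j' < n \<Longrightarrow> k < dE j' i \<Longrightarrow> l \<in> L j i \<Longrightarrow>
      y < dY j \<Longrightarrow> y' < dY j' \<Longrightarrow>
      (\<Sum>x<dX i. \<Sum>h<d. T i j' k y' x h * S j i l x y h) = (if j = j' \<and> y = y' then \<mu> i j k l else 0)"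
    and S_tp: "\<And>j y y' h h'. j < n \<Longrightarrow> y < dY j \<Longrightarrow> y' < dY j \<Longrightarrow> h < d \<Longrightarrow> h' < d \<Longrightarrow>
      (\<Sum>i<m. \<Sum>l\<in>L j i. \<Sum>x<dX i. cnj (S j i l x y h) * S j i l x y' h') = (if y = y' then Q h h' else 0)"
    and Q_inv: "\<And>h h'. h < d \<Longrightarrow> h' < d \<Longrightarrow> (\<Sum>a<d. Qi h a * Q a h') = (if h = h' then 1 else 0)"
begin

text \<open>For fixed \<open>y\<close>, \<open>S j i l\<close> is a vector in X_i \<otimes> H. The
  isometry \<tau>_i determines it by its image, and by \<open>T_S\<close> that image lives only in
  the component (j,y), with coordinates \<open>\<mu>\<close>.\<close>

lemma S_eq_adjoint:
  assumes "i < m" "j < n" "l \<in> L j i" "x < dX i" "y < dY j" "h < d"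
  shows "S j i l x y h = (\<Sum>k<dE j i. cnj (T i j k y x h) * \<mu> i j k l)"
proof -
  have "S j i l x y h = (\<Sum>x'<dX i. \<Sum>h'<d. (if x = x' \<and> h = h' then 1 else 0) * S j i l x' y h')"
    using assms by (simp only: sum_delta2_mult)
  also have "\<dots> = (\<Sum>x'<dX i. \<Sum>h'<d. (\<Sum>j'<n. \<Sum>k<dE j' i. \<Sum>y'<dY j'.
      cnj (T i j' k y' x h) * T i j' k y' x' h') * S j i l x' y h')"
    using assms by (intro sum.cong refl) (simp add: T_tp)
  also have "\<dots> = (\<Sum>j'<n. \<Sum>k<dE j' i. \<Sum>y'<dY j'. cnj (T i j' k y' x h) *
      (\<Sum>x'<dX i. \<Sum>h'<d. T i j' k y' x' h' * S j i l x' y h'))"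
    by (rule sum_exchange_3_2)
  also have "\<dots> = (\<Sum>j'<n. \<Sum>k<dE j' i. \<Sum>y'<dY j'. cnj (T i j' k y' x h) *
      (if j = j' \<and> y = y' then \<mu> i j k l else 0))"
    using assms by (intro sum.cong refl) (simp add: T_S)
  also have "\<dots> = (\<Sum>j'<n. if j = j' then \<Sum>k<dE j' i. cnj (T i j' k y x h) * \<mu> i j k l else 0)"
    using assms by (intro sum.cong refl)
      (auto simp: if_distrib[of "\<lambda>z. _ * z"] cong: if_cong)
  also have "\<dots> = (\<Sum>k<dE j i. cnj (T i j k y x h) * \<mu> i j k l)"
    using assms by simp
  finally show ?thesis .
qed

text \<open>This is \<kappa> = \<mu> \<Lambda>, from inserting \<open>S_eq_adjoint\<close> into
  \<open>S_T\<close> at column 0.\<close>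

lemma lam_eq:
  assumes "i < m" "j < n" "k < dE j i" "l \<in> L j i"
  shows "\<kappa> i j k l = (\<Sum>k'<dE j i. \<mu> i j k' l * gram i j k' k)"
proof -
  note X = dE_pos_imp_dX_pos[OF assms(1-3)]
  have "\<kappa> i j k l = (\<Sum>y<dY j. \<Sum>h<d. S j i l 0 y h * T i j k y 0 h)"
    using S_T[of i i j k l 0 0] assms X by simp
  also have "\<dots> = (\<Sum>y<dY j. \<Sum>h<d. (\<Sum>k'<dE j i. \<mu> i j k' l * cnj (T i j k' y 0 h)) * T i j k y 0 h)"
    using assms X by (intro sum.cong refl) (simp add: S_eq_adjoint mult.commute)
  also have "\<dots> = (\<Sum>k'<dE j i. \<mu> i j k' l * gram i j k' k)"
    unfolding gram_def by (rule sum_exchange_1_2)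
  finally show ?thesis .
qed

lemma Q_cancel:
  assumes "\<And>h. h < d \<Longrightarrow> (\<Sum>h'<d. Q h h' * b h') = 0" "h < d"
  shows "b h = 0"
proof -
  have "b h = (\<Sum>h'<d. (if h = h' then 1 else 0) * b h')" using assms(2) by (simp add: sum_delta_mult)
  also have "\<dots> = (\<Sum>h'<d. (\<Sum>a<d. Qi h a * Q a h') * b h')"
    using assms(2) by (intro sum.cong refl) (simp add: Q_inv)
  also have "\<dots> = (\<Sum>a<d. Qi h a * (\<Sum>h'<d. Q a h' * b h'))" by (rule sum_mult_exchange[symmetric])
  also have "\<dots> = 0" using assms(1) by simp
  finally show ?thesis .
qed

text \<open>Expresses 1 \<otimes> Q through the images S b. Together with \<open>Q_cancel\<close> it
  shows that a vector \<open>b\<close> annihilated by all S is zero.\<close>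

lemma S_tp_apply:
  assumes "j < n" "y < dY j" "h < d"
  shows "(\<Sum>h'<d. Q h h' * b y h')
    = (\<Sum>i<m. \<Sum>l\<in>L j i. \<Sum>x<dX i. cnj (S j i l x y h) * (\<Sum>y'<dY j. \<Sum>h'<d. S j i l x y' h' * b y' h'))"
proof -
  have "(\<Sum>h'<d. Q h h' * b y h') = (\<Sum>y'<dY j. if y = y' then \<Sum>h'<d. Q h h' * b y' h' else 0)"
    using assms by simp
  also have "\<dots> = (\<Sum>y'<dY j. \<Sum>h'<d. (\<Sum>i<m. \<Sum>l\<in>L j i. \<Sum>x<dX i.
      cnj (S j i l x y h) * S j i l x y' h') * b y' h')"
    using assms by (intro sum.cong refl) (auto simp: S_tp)
  also have "\<dots> = (\<Sum>i<m. \<Sum>l\<in>L j i. \<Sum>x<dX i. cnj (S j i l x y h) *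
      (\<Sum>y'<dY j. \<Sum>h'<d. S j i l x y' h' * b y' h'))"
    by (rule sum_exchange_3_2)
  finally show ?thesis .
qed

text \<open>Each column of the combination of the T with coefficients \<open>c\<close> is
  annihilated by all S: by \<open>S_T\<close> the only possible value is \<open>\<kappa>\<close>
  applied to \<open>c\<close>. So the combination vanishes, and minimality gives c = 0.\<close>

lemma lam_injective:
  assumes ij: "i < m" "j < n" and c: "\<And>l. l \<in> L j i \<Longrightarrow> (\<Sum>k<dE j i. \<kappa> i j k l * c k) = 0"
  shows "\<forall>k<dE j i. c k = 0"
proof (rule T_indep[OF ij])
  fix y x h assume A: "y < dY j" "x < dX i" "h < d"
  define b where "b y h = (\<Sum>k<dE j i. c k * T i j k y x h)" for y h
  have z: "(\<Sum>y'<dY j. \<Sum>h'<d. S j i' l x' y' h' * b y' h') = 0"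
    if "i' < m" "l \<in> L j i'" "x' < dX i'" for i' l x'
  proof -
    have "(\<Sum>y'<dY j. \<Sum>h'<d. S j i' l x' y' h' * b y' h')
      = (\<Sum>k<dE j i. c k * (\<Sum>y'<dY j. \<Sum>h'<d. T i j k y' x h' * S j i' l x' y' h'))"
      unfolding b_def by (subst sum_exchange_1_2[symmetric]) (simp add: mult.commute)
    also have "\<dots> = (\<Sum>k<dE j i. c k * (if i = i' \<and> x = x' then \<kappa> i j k l else 0))"
      using ij A that by (intro sum.cong refl) (simp add: S_T[symmetric] mult.commute)
    also have "\<dots> = 0" 
    proof (cases "i = i' \<and> x = x'")
      case True
      then show ?thesis using c that by (simp add: mult.commute)
    next
      case False
      then show ?thesis by (intro sum.neutral) auto
    qed
    finally show ?thesis .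
  qed
  have "b y h = 0"
  proof (rule Q_cancel[OF _ A(3)])
    fix h assume "h < d"
    then show "(\<Sum>h'<d. Q h h' * b y h') = 0"
      using A ij by (simp add: S_tp_apply z)
  qed
  then show "(\<Sum>k<dE j i. c k * T i j k y x h) = 0" by (simp add: b_def)
qed

text \<open>Applying \<open>S_tp_apply\<close> to a column of T leaves, by \<open>S_T\<close>, only
  the same block and column; expanding the remaining adjoint of S by \<open>S_eq_adjoint\<close>
  returns to the T.\<close>

lemma intertwiner:
  assumes "i < m" "j < n" "k < dE j i" "y < dY j" "x < dX i" "h < d"
  shows "(\<Sum>h'<d. Q h h' * T i j k y x h')
    = (\<Sum>k'<dE j i. (\<Sum>l\<in>L j i. \<kappa> i j k l * cnj (\<mu> i j k' l)) * T i j k' y x h)"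
proof -
  have "(\<Sum>h'<d. Q h h' * T i j k y x h')
    = (\<Sum>i'<m. \<Sum>l\<in>L j i'. \<Sum>x'<dX i'. cnj (S j i' l x' y h) * (if i = i' \<and> x = x' then \<kappa> i j k l else 0))"
    using assms by (subst S_tp_apply) (auto intro!: sum.cong simp: S_T)
  also have "\<dots> = (\<Sum>i'<m. if i = i' then (\<Sum>l\<in>L j i'. cnj (S j i' l x y h) * \<kappa> i j k l) else 0)"
    using assms by (intro sum.cong refl) (auto simp: if_distrib[of "\<lambda>z. _ * z"] cong: if_cong)
  also have "\<dots> = (\<Sum>l\<in>L j i. \<kappa> i j k l * cnj (S j i l x y h))"
    using assms by (simp add: mult.commute)
  also have "\<dots> = (\<Sum>l\<in>L j i. \<kappa> i j k l * (\<Sum>k'<dE j i. cnj (\<mu> i j k' l) * T i j k' y x h))"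
    using assms by (intro sum.cong refl) (simp add: S_eq_adjoint mult.commute)
  finally show ?thesis by (simp only: sum_mult_exchange)
qed

lemma gram_cnj: "cnj (gram i j a b) = gram i j b a"
  by (simp add: gram_def mult.commute)

text \<open>A kernel vector of \<Lambda> is one of \<kappa> = \<mu> \<Lambda>, which is
  injective.\<close>

lemma gram_inverse:
  assumes ij: "i < m" "j < n"
  obtains P where "\<And>a b. a < dE j i \<Longrightarrow> b < dE j i \<Longrightarrow> (\<Sum>k<dE j i. gram i j a k * P k b) = (if a = b then 1 else 0)"
    and "\<And>a b. a < dE j i \<Longrightarrow> b < dE j i \<Longrightarrow> (\<Sum>k<dE j i. P a k * gram i j k b) = (if a = b then 1 else 0)"
proof (rule injective_imp_inverse[of "dE j i" "gram i j"])
  fix c assume c: "\<And>a. a < dE j i \<Longrightarrow> (\<Sum>b<dE j i. gram i j a b * c b) = 0"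
  show "\<forall>b<dE j i. c b = 0"
  proof (rule lam_injective[OF ij])
    fix l assume "l \<in> L j i"
    then have "(\<Sum>k<dE j i. \<kappa> i j k l * c k) = (\<Sum>k<dE j i. (\<Sum>k'<dE j i. \<mu> i j k' l * gram i j k' k) * c k)"
      using ij by (simp add: lam_eq)
    also have "\<dots> = (\<Sum>k'<dE j i. \<mu> i j k' l * (\<Sum>k<dE j i. gram i j k' k * c k))"
      by (rule sum_mult_exchange[symmetric])
    also have "\<dots> = 0" using c by simp
    finally show "(\<Sum>k<dE j i. \<kappa> i j k l * c k) = 0" .
  qed
qed (rule that)

text \<open>Write c = \<Lambda> b. Then \<mu> c = \<kappa> b, so b = 0 and hence c = 0.\<close>

lemma mu_injective:
  assumes ij: "i < m" "j < n" and c: "\<And>l. l \<in> L j i \<Longrightarrow> (\<Sum>k<dE j i. \<mu> i j k l * c k) = 0"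
    and k: "k < dE j i"
  shows "c k = 0"
proof -
  obtain P where P: "\<And>a b. a < dE j i \<Longrightarrow> b < dE j i \<Longrightarrow> (\<Sum>k<dE j i. gram i j a k * P k b) = (if a = b then 1 else 0)"
    by (rule gram_inverse[OF ij]) (rule that)
  define b where "b a = (\<Sum>k<dE j i. P a k * c k)" for a
  have c_eq: "c a = (\<Sum>k<dE j i. gram i j a k * b k)" if "a < dE j i" for a
    unfolding b_def using that by (simp add: sum_mult_exchange P sum_delta_mult)
  have "\<forall>k<dE j i. b k = 0"
  proof (rule lam_injective[OF ij])
    fix l assume l: "l \<in> L j i"
    have "(\<Sum>k<dE j i. \<kappa> i j k l * b k) = (\<Sum>k<dE j i. (\<Sum>k'<dE j i. \<mu> i j k' l * gram i j k' k) * b k)"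
      using ij l by (simp add: lam_eq)
    also have "\<dots> = (\<Sum>k'<dE j i. \<mu> i j k' l * (\<Sum>k<dE j i. gram i j k' k * b k))"
      by (rule sum_mult_exchange[symmetric])
    also have "\<dots> = 0" using c[OF l] by (simp add: c_eq)
    finally show "(\<Sum>k<dE j i. \<kappa> i j k l * b k) = 0" .
  qed
  then show ?thesis using k by (simp add: c_eq)
qed

lemma mu_cancel:
  assumes ij: "i < m" "j < n"
    and c: "\<And>l. l \<in> L j i \<Longrightarrow> (\<Sum>k<dE j i. \<mu> i j k l * c k) = (\<Sum>k<dE j i. \<mu> i j k l * b k)"
    and k: "k < dE j i"
  shows "c k = b k"
  using mu_injective[OF ij _ k, of "\<lambda>k. c k - b k"] c by (simp add: right_diff_distrib sum_subtractf)

text \<open>\<open>T_tp\<close> gives only the product in the other order. Contracting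
  \<open>k\<close> with \<mu>^l turns the adjoint of T into S, and \<open>T_S\<close> then evaluates
  the sum.\<close>

lemma T_unitary:
  assumes "i < m" "j < n" "j' < n" "k < dE j i" "k' < dE j' i" "y < dY j" "y' < dY j'"
  shows "(\<Sum>x<dX i. \<Sum>h<d. T i j' k' y' x h * cnj (T i j k y x h))
        = (if j = j' \<and> y = y' then if k = k' then 1 else 0 else 0)"
proof -
  have "(\<Sum>x<dX i. \<Sum>h<d. cnj (T i j k y x h) * T i j' k' y' x h)
        = (if j = j' \<and> y = y' then if k = k' then 1 else 0 else 0)"
  proof (rule mu_cancel[OF assms(1,2) _ assms(4)])
    fix l assume l: "l \<in> L j i"
    have "(\<Sum>k<dE j i. \<mu> i j k l * (\<Sum>x<dX i. \<Sum>h<d. cnj (T i j k y x h) * T i j' k' y' x h))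
       = (\<Sum>x<dX i. \<Sum>h<d. (\<Sum>k<dE j i. \<mu> i j k l * cnj (T i j k y x h)) * T i j' k' y' x h)"
      by (rule sum_exchange_1_2[symmetric])
    also have "\<dots> = (\<Sum>x<dX i. \<Sum>h<d. T i j' k' y' x h * S j i l x y h)"
      using assms l by (intro sum.cong refl) (simp add: S_eq_adjoint mult.commute)
    also have "\<dots> = (if j = j' \<and> y = y' then \<mu> i j k' l else 0)"
      using assms l by (simp add: T_S)
    also have "\<dots> = (\<Sum>k<dE j i. \<mu> i j k l * (if j = j' \<and> y = y' then if k = k' then 1 else 0 else 0))"
      using assms by (auto simp: sum_delta_mult)
    finally show "(\<Sum>k<dE j i. \<mu> i j k l * (\<Sum>x<dX i. \<Sum>h<d. cnj (T i j k y x h) * T i j' k' y' x h))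
      = (\<Sum>k<dE j i. \<mu> i j k l * (if j = j' \<and> y = y' then if k = k' then 1 else 0 else 0))" .
  qed
  then show ?thesis by (simp add: mult.commute)
qed

text \<open>The same contraction, evaluated by \<open>S_T\<close> and \<open>lam_eq\<close>. In
  particular \<open>gram\<close>, defined at column 0, is the same at every column.\<close>

lemma T_dual_orthogonal:
  assumes "j < n" "i < m" "i' < m" "k < dE j i" "k' < dE j i'" "x < dX i" "x' < dX i'"
  shows "(\<Sum>y<dY j. \<Sum>h<d. cnj (T i' j k' y x' h) * T i j k y x h)
        = (if i = i' \<and> x = x' then gram i j k' k else 0)"
proof (rule mu_cancel[OF assms(3,1) _ assms(5)])
  fix l assume l: "l \<in> L j i'"
  have "(\<Sum>k'<dE j i'. \<mu> i' j k' l * (\<Sum>y<dY j. \<Sum>h<d. cnj (T i' j k' y x' h) * T i j k y x h))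
     = (\<Sum>y<dY j. \<Sum>h<d. (\<Sum>k'<dE j i'. \<mu> i' j k' l * cnj (T i' j k' y x' h)) * T i j k y x h)"
    by (rule sum_exchange_1_2[symmetric])
  also have "\<dots> = (\<Sum>y<dY j. \<Sum>h<d. S j i' l x' y h * T i j k y x h)"
    using assms l by (intro sum.cong refl) (simp add: S_eq_adjoint mult.commute)
  also have "\<dots> = (if i = i' \<and> x = x' then \<kappa> i j k l else 0)"
    using assms l by (simp add: S_T)
  also have "\<dots> = (\<Sum>k'<dE j i'. \<mu> i' j k' l * (if i = i' \<and> x = x' then gram i j k' k else 0))"
    using assms l by (auto simp: lam_eq)
  finally show "(\<Sum>k'<dE j i'. \<mu> i' j k' l * (\<Sum>y<dY j. \<Sum>h<d. cnj (T i' j k' y x' h) * T i j k y x h))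
     = (\<Sum>k'<dE j i'. \<mu> i' j k' l * (if i = i' \<and> x = x' then gram i j k' k else 0))" .
qed

text \<open>By \<open>S_eq_adjoint\<close>, a vector orthogonal to all columns of T is annihilated
  by all S. This is the completeness behind the last biunitarity condition.\<close>

lemma ortho_T_imp_zero:
  assumes j: "j < n"
    and b: "\<And>i k x. i < m \<Longrightarrow> k < dE j i \<Longrightarrow> x < dX i \<Longrightarrow> (\<Sum>y<dY j. \<Sum>h<d. cnj (T i j k y x h) * b y h) = 0"
    and yh: "y < dY j" "h < d"
  shows "b y h = 0"
proof (rule Q_cancel[OF _ yh(2)])
  fix h assume "h < d"
  have "(\<Sum>y'<dY j. \<Sum>h'<d. S j i l x y' h' * b y' h') = 0" if "i < m" "l \<in> L j i" "x < dX i" for i l x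
  proof -
    have "(\<Sum>y'<dY j. \<Sum>h'<d. S j i l x y' h' * b y' h')
      = (\<Sum>y'<dY j. \<Sum>h'<d. (\<Sum>k<dE j i. \<mu> i j k l * cnj (T i j k y' x h')) * b y' h')"
      using that j by (intro sum.cong refl) (simp add: S_eq_adjoint mult.commute)
    also have "\<dots> = (\<Sum>k<dE j i. \<mu> i j k l * (\<Sum>y'<dY j. \<Sum>h'<d. cnj (T i j k y' x h') * b y' h'))"
      by (rule sum_exchange_1_2)
    also have "\<dots> = 0" using b that by simp
    finally show ?thesis .
  qed
  then show "(\<Sum>h'<d. Q h h' * b y h') = 0" using j yh \<open>h < d\<close> by (simp add: S_tp_apply)
qed

lemma biunitary_ex: "\<exists>P. biunitary P"
proof -
  define good where "good i j P \<longleftrightarrow> (\<forall>a<dE j i. \<forall>b<dE j i.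
      (\<Sum>k<dE j i. gram i j a k * P k b) = (if a = b then 1 else 0) \<and>
      (\<Sum>k<dE j i. P a k * gram i j k b) = (if a = b then 1 else 0))" for i j P
  define P where "P i j = (SOME P. good i j P)" for i j
  have "good i j (P i j)" if ij: "i < m" "j < n" for i j
  proof -
    obtain P' where P': "\<And>a b. a < dE j i \<Longrightarrow> b < dE j i \<Longrightarrow> (\<Sum>k<dE j i. gram i j a k * P' k b) = (if a = b then 1 else 0)"
      "\<And>a b. a < dE j i \<Longrightarrow> b < dE j i \<Longrightarrow> (\<Sum>k<dE j i. P' a k * gram i j k b) = (if a = b then 1 else 0)"
      by (rule gram_inverse[OF ij]) (rule that)
    have "good i j P'" unfolding good_def by (intro allI impI conjI P')
    then show ?thesis unfolding P_def by (rule someI[of "good i j"])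
  qed
  then have P:
    "\<And>i j a b. i < m \<Longrightarrow> j < n \<Longrightarrow> a < dE j i \<Longrightarrow> b < dE j i \<Longrightarrow>
      (\<Sum>k<dE j i. gram i j a k * P i j k b) = (if a = b then 1 else 0)"
    "\<And>i j a b. i < m \<Longrightarrow> j < n \<Longrightarrow> a < dE j i \<Longrightarrow> b < dE j i \<Longrightarrow>
      (\<Sum>k<dE j i. P i j a k * gram i j k b) = (if a = b then 1 else 0)"
    unfolding good_def by blast+
  \<comment> \<open>\<Lambda> is Hermitian, so the adjoint of its left inverse \<open>P\<close> is a
    right inverse, and the two coincide.\<close>
  have P_cnj: "P i j a b = cnj (P i j b a)" if ij: "i < m" "j < n" and ab: "a < dE j i" "b < dE j i" for i j a b
  proof -
    have adj: "(\<Sum>k'<dE j i. gram i j k k' * cnj (P i j b k')) = (if b = k then 1 else 0)" if "k < dE j i" for k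
    proof -
      have "(\<Sum>k'<dE j i. gram i j k k' * cnj (P i j b k')) = cnj (\<Sum>k'<dE j i. P i j b k' * gram i j k' k)"
        by (simp add: gram_cnj mult.commute)
      then show ?thesis using P(2)[OF ij ab(2) that] by simp
    qed
    have "P i j a b = (\<Sum>k<dE j i. P i j a k * (if b = k then 1 else 0))"
      using ab by (simp add: sum_delta_mult)
    also have "\<dots> = (\<Sum>k<dE j i. P i j a k * (\<Sum>k'<dE j i. gram i j k k' * cnj (P i j b k')))"
      by (simp add: adj)
    also have "\<dots> = (\<Sum>k'<dE j i. (\<Sum>k<dE j i. P i j a k * gram i j k k') * cnj (P i j b k'))"
      by (rule sum_mult_exchange)
    also have "\<dots> = cnj (P i j b a)" using ij ab by (simp add: P(2) sum_delta_mult)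
    finally show ?thesis .
  qed
  have P_dual: "(\<Sum>i<m. \<Sum>k<dE j i. \<Sum>x<dX i. T i j k y x h * (\<Sum>k'<dE j i. P i j k k' * cnj (T i j k' y' x h')))
        = (if y = y' \<and> h = h' then 1 else 0)"
    if j: "j < n" and yh: "y < dY j" "y' < dY j" "h < d" "h' < d" for j y y' h h'
  proof -
    define r where "r i k x = (\<Sum>k'<dE j i. P i j k k' * cnj (T i j k' y' x h'))" for i k x
    \<comment> \<open>\<open>F\<close> is column (y',h') of T P T^*, with T reshuffled. Its
      difference from the unit vector is orthogonal to all columns of T because T^* T P T^* =
      \<Lambda> P T^* = T^*.\<close>
    define F where "F y h = (\<Sum>i<m. \<Sum>k<dE j i. \<Sum>x<dX i. r i k x * T i j k y x h)" for y h
    have "F y h - (if y = y' \<and> h = h' then 1 else 0) = 0"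
    proof (rule ortho_T_imp_zero[OF j _ yh(1,3)])
      fix i k x assume ikx: "i < m" "k < dE j i" "x < dX i"
      have "(\<Sum>y<dY j. \<Sum>h<d. cnj (T i j k y x h) * F y h)
        = (\<Sum>i'<m. \<Sum>k'<dE j i'. \<Sum>x'<dX i'. r i' k' x' *
            (\<Sum>y<dY j. \<Sum>h<d. T i' j k' y x' h * cnj (T i j k y x h)))"
        unfolding F_def by (subst sum_exchange_3_2[symmetric]) (simp add: mult.commute)
      also have "\<dots> = (\<Sum>i'<m. \<Sum>k'<dE j i'. \<Sum>x'<dX i'. r i' k' x' *
            (if i' = i \<and> x' = x then gram i j k k' else 0))"
        using j ikx by (intro sum.cong refl)
          (simp add: mult.commute[of "T _ _ _ _ _ _" "cnj _"] T_dual_orthogonal)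
      also have "\<dots> = (\<Sum>i'<m. if i' = i then \<Sum>k'<dE j i'. r i' k' x * gram i j k k' else 0)"
        using ikx by (intro sum.cong refl) (auto simp: if_distrib[of "\<lambda>z. _ * z"] cong: if_cong)
      also have "\<dots> = (\<Sum>k'<dE j i. gram i j k k' * r i k' x)"
        using ikx by (simp add: mult.commute)
      also have "\<dots> = cnj (T i j k y' x h')"
        unfolding r_def using ikx j by (simp add: sum_mult_exchange P sum_delta_mult)
      also have "\<dots> = (\<Sum>y<dY j. if y = y' then \<Sum>h<d. cnj (T i j k y x h) * (if h = h' then 1 else 0) else 0)"
        using yh by (simp add: sum_delta_mult)
      also have "\<dots> = (\<Sum>y<dY j. \<Sum>h<d. cnj (T i j k y x h) * (if y = y' \<and> h = h' then 1 else 0))"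
        by (intro sum.cong refl) auto
      finally show "(\<Sum>y<dY j. \<Sum>h<d. cnj (T i j k y x h) * (F y h - (if y = y' \<and> h = h' then 1 else 0))) = 0"
        by (simp only: right_diff_distrib sum_subtractf diff_self)
    qed
    then show ?thesis by (simp add: F_def r_def mult.commute)
  qed
  show ?thesis
    unfolding biunitary_def
    by (intro exI[of _ P] conjI allI impI T_unitary T_dual_orthogonal P(2) P_cnj P_dual)
qed

end

section \<open>Sufficiency: an inverse built from a biunitary and an intertwiner\<close>

context tp_kraus
begin

context
  fixes P :: "nat \<Rightarrow> nat \<Rightarrow> nat \<Rightarrow> nat \<Rightarrow> complex"
    and w :: "nat \<Rightarrow> nat \<Rightarrow> complex"
    and g :: "nat \<Rightarrow> nat \<Rightarrow> nat \<Rightarrow> nat \<Rightarrow> complex"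
  assumes P: "biunitary P"
    and g: "\<And>i j k y x h. i < m \<Longrightarrow> j < n \<Longrightarrow> k < dE j i \<Longrightarrow> y < dY j \<Longrightarrow> x < dX i \<Longrightarrow> h < d \<Longrightarrow>
      (\<Sum>h'<d. (\<Sum>a<d. cnj (w a h) * w a h') * T i j k y x h') = (\<Sum>k'<dE j i. g i j k k' * T i j k' y x h)"
    and w: "(\<Sum>h<d. \<Sum>a<d. cnj (w a h) * w a h) = 1"
begin

lemma T_unitary':
  assumes "i < m" "j < n" "j' < n" "k < dE j i" "k' < dE j' i" "y < dY j" "y' < dY j'"
  shows "(\<Sum>x<dX i. \<Sum>h<d. T i j' k' y' x h * cnj (T i j k y x h))
        = (if j = j' \<and> y = y' then if k = k' then 1 else 0 else 0)"
  by (rule P[unfolded biunitary_def, THEN conjunct1, rule_format, OF assms])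

lemma T_dual_orthogonal':
  assumes "j < n" "i < m" "i' < m" "k < dE j i" "k' < dE j i'" "x < dX i" "x' < dX i'"
  shows "(\<Sum>y<dY j. \<Sum>h<d. cnj (T i' j k' y x' h) * T i j k y x h)
        = (if i = i' \<and> x = x' then gram i j k' k else 0)"
  by (rule P[unfolded biunitary_def, THEN conjunct2, THEN conjunct1, rule_format, OF assms])

lemma P_gram:
  assumes "i < m" "j < n" "a < dE j i" "b < dE j i"
  shows "(\<Sum>k<dE j i. P i j a k * gram i j k b) = (if a = b then 1 else 0)"
    and "cnj (P i j b a) = P i j a b"
  using P[unfolded biunitary_def, THEN conjunct2, THEN conjunct2, THEN conjunct1, rule_format, OF assms]
  by (rule conjunct1, rule conjunct2[THEN sym])

lemma T_P_T:
  assumes "j < n" "y < dY j" "y' < dY j" "h < d" "h' < d"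
  shows "(\<Sum>i<m. \<Sum>k<dE j i. \<Sum>x<dX i. T i j k y x h * (\<Sum>k'<dE j i. P i j k k' * cnj (T i j k' y' x h')))
        = (if y = y' \<and> h = h' then 1 else 0)"
  by (rule P[unfolded biunitary_def, THEN conjunct2, THEN conjunct2, THEN conjunct2, rule_format, OF assms])

text \<open>
  The coefficient vectors of the inverse are indexed by \<open>(a, y)\<close>. Taking column \<open>x = 0\<close> of
  $\sum_h \omega_{ah} T_h$ gives a factorisation of $\Lambda G \Lambda$ without a matrix square root,
  and \<open>mu\<close> undoes one factor $\Lambda$.
\<close>
definition kap :: "nat \<Rightarrow> nat \<Rightarrow> nat \<Rightarrow> nat \<times> nat \<Rightarrow> complex" where
  "kap i j k l = (\<Sum>h<d. w (fst l) h * T i j k (snd l) 0 h)"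

definition mu :: "nat \<Rightarrow> nat \<Rightarrow> nat \<Rightarrow> nat \<times> nat \<Rightarrow> complex" where
  "mu i j k l = (\<Sum>k'<dE j i. kap i j k' l * P i j k' k)"

text \<open>The formula of \<open>S_eq_adjoint\<close>, now as a definition. The amplitude matrix
  \<open>w\<close> is still absorbed in the H-leg.\<close>

definition inv_kraus :: "nat \<Rightarrow> nat \<Rightarrow> nat \<times> nat \<Rightarrow> nat \<Rightarrow> nat \<Rightarrow> nat \<Rightarrow> complex" where
  "inv_kraus j i l x y h = (\<Sum>k<dE j i. mu i j k l * cnj (T i j k y x h))"

abbreviation LL where "LL j \<equiv> {..<d} \<times> {..<dY j}"

lemma mu_gram:
  assumes "i < m" "j < n" "k < dE j i"
  shows "(\<Sum>k'<dE j i. mu i j k' l * gram i j k' k) = kap i j k l"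
  unfolding mu_def using assms by (simp add: sum_mult_exchange[symmetric] P_gram sum_delta_mult)

lemma inv_kraus_T:
  assumes "i < m" "i' < m" "j < n" "k < dE j i" "x < dX i" "x' < dX i'"
  shows "(\<Sum>y<dY j. \<Sum>h<d. inv_kraus j i' l x' y h * T i j k y x h) = (if i = i' \<and> x = x' then kap i j k l else 0)"
proof -
  have "(\<Sum>y<dY j. \<Sum>h<d. inv_kraus j i' l x' y h * T i j k y x h)
    = (\<Sum>k'<dE j i'. mu i' j k' l * (\<Sum>y<dY j. \<Sum>h<d. cnj (T i' j k' y x' h) * T i j k y x h))"
    unfolding inv_kraus_def by (rule sum_exchange_1_2)
  also have "\<dots> = (\<Sum>k'<dE j i'. mu i' j k' l * (if i = i' \<and> x = x' then gram i j k' k else 0))"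
    using assms by (intro sum.cong refl) (simp add: T_dual_orthogonal')
  also have "\<dots> = (if i = i' \<and> x = x' then kap i j k l else 0)"
    using assms by (auto simp: mu_gram)
  finally show ?thesis .
qed

lemma T_inv_kraus:
  assumes "i < m" "j < n" "j' < n" "k < dE j' i" "y < dY j" "y' < dY j'"
  shows "(\<Sum>x<dX i. \<Sum>h<d. T i j' k y' x h * inv_kraus j i l x y h) = (if j = j' \<and> y = y' then mu i j k l else 0)"
proof -
  have "(\<Sum>x<dX i. \<Sum>h<d. T i j' k y' x h * inv_kraus j i l x y h)
    = (\<Sum>x<dX i. \<Sum>h<d. (\<Sum>k'<dE j i. mu i j k' l * cnj (T i j k' y x h)) * T i j' k y' x h)"
    unfolding inv_kraus_def by (intro sum.cong refl) (rule mult.commute)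
  also have "\<dots> = (\<Sum>k'<dE j i. mu i j k' l * (\<Sum>x<dX i. \<Sum>h<d. cnj (T i j k' y x h) * T i j' k y' x h))"
    by (rule sum_exchange_1_2)
  also have "\<dots> = (\<Sum>k'<dE j i. mu i j k' l * (\<Sum>x<dX i. \<Sum>h<d. T i j' k y' x h * cnj (T i j k' y x h)))"
    by (simp add: mult.commute)
  also have "\<dots> = (\<Sum>k'<dE j i. mu i j k' l * (if j = j' \<and> y = y' then if k' = k then 1 else 0 else 0))"
    using assms by (intro sum.cong refl) (simp add: T_unitary')
  also have "\<dots> = (if j = j' \<and> y = y' then mu i j k l else 0)"
    using assms by (auto simp: sum_delta_mult)
  finally show ?thesis .
qed

text \<open>Summing over the component \<open>a\<close> of the index pair produces
  \<omega>^*\<omega> between two columns of T at 0; the intertwiner equation trades it for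
  \<open>g\<close>, and what remains is \<Lambda>.\<close>

lemma kap_kap:
  assumes "i < m" "j < n" "k < dE j i" "k' < dE j i"
  shows "(\<Sum>l\<in>LL j. cnj (kap i j k' l) * kap i j k l) = (\<Sum>k2<dE j i. g i j k k2 * gram i j k' k2)"
proof -
  note X = dE_pos_imp_dX_pos[OF assms(1-3)]
  have "(\<Sum>l\<in>LL j. cnj (kap i j k' l) * kap i j k l)
    = (\<Sum>y<dY j. \<Sum>a<d. cnj (kap i j k' (a, y)) * kap i j k (a, y))"
    by (subst sum.swap) (simp add: sum.cartesian_product case_prod_unfold)
  also have "\<dots> = (\<Sum>y<dY j. \<Sum>h<d. cnj (T i j k' y 0 h) *
      (\<Sum>h'<d. (\<Sum>a<d. cnj (w a h) * w a h') * T i j k y 0 h'))" (is "_ = (\<Sum>y<dY j. ?r y)")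
  proof (rule sum.cong[OF refl])
    fix y
    have "(\<Sum>a<d. cnj (kap i j k' (a, y)) * kap i j k (a, y))
      = (\<Sum>a<d. \<Sum>h<d. cnj (T i j k' y 0 h) * (cnj (w a h) * (\<Sum>h'<d. w a h' * T i j k y 0 h')))"
      by (simp only: kap_def fst_conv snd_conv cnj_sum complex_cnj_mult sum_distrib_right) (simp only: mult_ac)
    also have "\<dots> = (\<Sum>h<d. cnj (T i j k' y 0 h) * (\<Sum>a<d. cnj (w a h) * (\<Sum>h'<d. w a h' * T i j k y 0 h')))"
      by (subst sum.swap) (simp only: sum_distrib_left)
    also have "\<dots> = ?r y"
    proof -
      have "(\<Sum>a<d. cnj (w a h) * (\<Sum>h'<d. w a h' * T i j k y 0 h'))
        = (\<Sum>h'<d. (\<Sum>a<d. cnj (w a h) * w a h') * T i j k y 0 h')" for h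
        by (rule sum_mult_exchange)
      then show ?thesis by simp
    qed
    finally show "(\<Sum>a<d. cnj (kap i j k' (a, y)) * kap i j k (a, y)) = ?r y" .
  qed
  also have "\<dots> = (\<Sum>y<dY j. \<Sum>h<d. (\<Sum>k2<dE j i. g i j k k2 * T i j k2 y 0 h) * cnj (T i j k' y 0 h))"
    using assms X by (intro sum.cong refl) (subst g, simp_all add: mult.commute)
  also have "\<dots> = (\<Sum>k2<dE j i. g i j k k2 * gram i j k' k2)"
    unfolding gram_def by (subst sum_exchange_1_2) (simp add: mult.commute)
  finally show ?thesis .
qed

text \<open>Stripping \<Lambda> from both sides of \<open>kap_kap\<close> leaves the Gram matrix G =
  g \<Lambda>^-1, in transposed index order for \<open>g\<close>; the left factor is removed through
  the Hermitian symmetry of \<open>P\<close>.\<close>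

lemma mu_mu:
  assumes "i < m" "j < n" "k < dE j i" "k' < dE j i"
  shows "(\<Sum>l\<in>LL j. cnj (mu i j k l) * mu i j k' l) = (\<Sum>k2<dE j i. g i j k2 k * P i j k2 k')"
proof -
  have e: "cnj (mu i j k l) = (\<Sum>a<dE j i. P i j k a * cnj (kap i j a l))" for l
    unfolding mu_def using assms by (simp add: P_gram mult.commute)
  have "(\<Sum>l\<in>LL j. cnj (mu i j k l) * mu i j k' l)
     = (\<Sum>b<dE j i. (\<Sum>l\<in>LL j. cnj (mu i j k l) * kap i j b l) * P i j b k')"
    unfolding mu_def[of _ _ k'] by (rule sum_mult_exchange)
  also have "\<dots> = (\<Sum>b<dE j i. g i j b k * P i j b k')"
  proof (intro sum.cong refl arg_cong2[of _ _ _ _ "(*)"])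
    fix b assume b: "b \<in> {..<dE j i}"
    have "(\<Sum>l\<in>LL j. cnj (mu i j k l) * kap i j b l)
      = (\<Sum>a<dE j i. P i j k a * (\<Sum>l\<in>LL j. cnj (kap i j a l) * kap i j b l))"
      unfolding e by (rule sum_mult_exchange[symmetric])
    also have "\<dots> = (\<Sum>a<dE j i. P i j k a * (\<Sum>k2<dE j i. gram i j a k2 * g i j b k2))"
      using assms b by (intro sum.cong refl) (subst kap_kap, simp_all add: mult.commute)
    also have "\<dots> = g i j b k"
      using assms b by (simp add: sum_mult_exchange P_gram sum_delta_mult)
    finally show "(\<Sum>l\<in>LL j. cnj (mu i j k l) * kap i j b l) = g i j b k" .
  qed
  finally show ?thesis .
qed

text \<open>The sum is T G T^* with G = g P. The intertwiner equation turns g applied to T back into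
  \<omega>^*\<omega>, and T P T^* = 1 removes the rest.\<close>

lemma inv_kraus_tp:
  assumes "j < n" "y < dY j" "y' < dY j" "h < d" "h' < d"
  shows "(\<Sum>i<m. \<Sum>l\<in>LL j. \<Sum>x<dX i. cnj (inv_kraus j i l x y h) * inv_kraus j i l x y' h')
     = (if y = y' then \<Sum>a<d. cnj (w a h) * w a h' else 0)"
proof -
  have "(\<Sum>l\<in>LL j. cnj (inv_kraus j i l x y h) * inv_kraus j i l x y' h')
    = (\<Sum>k2<dE j i. (\<Sum>h1<d. (\<Sum>a<d. cnj (w a h) * w a h1) * T i j k2 y x h1) *
        (\<Sum>k'<dE j i. P i j k2 k' * cnj (T i j k' y' x h')))" (is "?l = _")
    if i: "i < m" and x: "x < dX i" for i x
  proof -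
    have "?l = (\<Sum>k'<dE j i. (\<Sum>l\<in>LL j. cnj (inv_kraus j i l x y h) * mu i j k' l) * cnj (T i j k' y' x h'))"
      unfolding inv_kraus_def[of _ _ _ _ y'] by (rule sum_mult_exchange)
    also have "\<dots> = (\<Sum>k'<dE j i. (\<Sum>k<dE j i. T i j k y x h * (\<Sum>l\<in>LL j. cnj (mu i j k l) * mu i j k' l)) * cnj (T i j k' y' x h'))"
      by (subst sum_mult_exchange) (simp add: inv_kraus_def mult.commute)
    also have "\<dots> = (\<Sum>k'<dE j i. (\<Sum>k<dE j i. T i j k y x h * (\<Sum>k2<dE j i. g i j k2 k * P i j k2 k')) * cnj (T i j k' y' x h'))"
      using i assms by (intro sum.cong refl arg_cong2[of _ _ _ _ "(*)"]) (simp_all add: mu_mu)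
    also have "\<dots> = (\<Sum>k'<dE j i. (\<Sum>k2<dE j i. (\<Sum>k<dE j i. g i j k2 k * T i j k y x h) * P i j k2 k') * cnj (T i j k' y' x h'))"
    proof -
      have "(\<Sum>k<dE j i. T i j k y x h * (\<Sum>k2<dE j i. g i j k2 k * P i j k2 k'))
        = (\<Sum>k2<dE j i. (\<Sum>k<dE j i. g i j k2 k * T i j k y x h) * P i j k2 k')" for k'
        by (subst sum_mult_exchange) (simp only: mult.commute)
      then show ?thesis by simp
    qed
    also have "\<dots> = (\<Sum>k2<dE j i. (\<Sum>k<dE j i. g i j k2 k * T i j k y x h) *
        (\<Sum>k'<dE j i. P i j k2 k' * cnj (T i j k' y' x h')))"
      by (rule sum_mult_exchange[symmetric])
    finally show ?thesis using i x assms by (simp add: g)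
  qed
  then have "(\<Sum>i<m. \<Sum>l\<in>LL j. \<Sum>x<dX i. cnj (inv_kraus j i l x y h) * inv_kraus j i l x y' h')
    = (\<Sum>i<m. \<Sum>k<dE j i. \<Sum>x<dX i. (\<Sum>h1<d. (\<Sum>a<d. cnj (w a h) * w a h1) * T i j k y x h1) *
        (\<Sum>k'<dE j i. P i j k k' * cnj (T i j k' y' x h')))"
    by (intro sum.cong refl) (subst (1 2) sum.swap, auto intro!: sum.cong)
  also have "\<dots> = (\<Sum>h1<d. (\<Sum>a<d. cnj (w a h) * w a h1) * (\<Sum>i<m. \<Sum>k<dE j i. \<Sum>x<dX i.
        T i j k y x h1 * (\<Sum>k'<dE j i. P i j k k' * cnj (T i j k' y' x h'))))"
    (is "?A = ?B")
  proof -
    have "?B = (\<Sum>h1<d. \<Sum>i<m. \<Sum>k<dE j i. \<Sum>x<dX i. (\<Sum>a<d. cnj (w a h) * w a h1) *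
        T i j k y x h1 * (\<Sum>k'<dE j i. P i j k k' * cnj (T i j k' y' x h')))"
      unfolding sum_distrib_left by (simp add: sum_distrib_left mult_ac)
    also have "\<dots> = (\<Sum>i<m. \<Sum>k<dE j i. \<Sum>x<dX i. \<Sum>h1<d. (\<Sum>a<d. cnj (w a h) * w a h1) *
        T i j k y x h1 * (\<Sum>k'<dE j i. P i j k k' * cnj (T i j k' y' x h')))"
      by (rule sum_swap_3[symmetric])
    finally show ?thesis by (simp only: sum_distrib_right)
  qed
  also have "\<dots> = (\<Sum>h1<d. (\<Sum>a<d. cnj (w a h) * w a h1) * (if y = y' \<and> h1 = h' then 1 else 0))"
    using assms by (intro sum.cong refl) (simp add: T_P_T)
  also have "\<dots> = (if y = y' then \<Sum>a<d. cnj (w a h) * w a h' else 0)"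
    using assms by (auto simp: sum_delta_mult)
  finally show ?thesis .
qed

text \<open>For fixed \<open>y\<close>, the squared norm of \<open>inv_kraus\<close> over X_i
  \<otimes> H is that of \<mu>^l; by \<open>inv_kraus_tp\<close> the total is the trace of
  \<omega>^*\<omega>.\<close>

lemma mu_norm:
  assumes "j < n" "y < dY j"
  shows "(\<Sum>i<m. \<Sum>k<dE j i. \<Sum>l\<in>LL j. mu i j k l * cnj (mu i j k l)) = 1"
proof -
  have "(\<Sum>x<dX i. \<Sum>h<d. cnj (inv_kraus j i l x y h) * inv_kraus j i l x y h)
    = (\<Sum>k<dE j i. mu i j k l * cnj (mu i j k l))" if "i < m" for i l
  proof -
    have "(\<Sum>x<dX i. \<Sum>h<d. cnj (inv_kraus j i l x y h) * inv_kraus j i l x y h)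
     = (\<Sum>x<dX i. \<Sum>h<d. (\<Sum>k<dE j i. cnj (mu i j k l) * T i j k y x h) * inv_kraus j i l x y h)"
      by (simp add: inv_kraus_def)
    also have "\<dots> = (\<Sum>k<dE j i. cnj (mu i j k l) * (\<Sum>x<dX i. \<Sum>h<d. T i j k y x h * inv_kraus j i l x y h))"
      by (rule sum_exchange_1_2)
    finally show ?thesis using that assms by (simp add: T_inv_kraus mult.commute)
  qed
  then have "(\<Sum>i<m. \<Sum>k<dE j i. \<Sum>l\<in>LL j. mu i j k l * cnj (mu i j k l))
    = (\<Sum>i<m. \<Sum>l\<in>LL j. \<Sum>x<dX i. \<Sum>h<d. cnj (inv_kraus j i l x y h) * inv_kraus j i l x y h)"
    by (intro sum.cong refl) (subst sum.swap, simp)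
  also have "\<dots> = (\<Sum>h<d. \<Sum>i<m. \<Sum>l\<in>LL j. \<Sum>x<dX i. cnj (inv_kraus j i l x y h) * inv_kraus j i l x y h)"
    by (rule sum_swap_3)
  also have "\<dots> = 1" using assms w by (simp add: inv_kraus_tp)
  finally show ?thesis .
qed

text \<open>Here the isometry \<open>T_tp\<close> at column 0 removes T, and again the trace of
  \<omega>^*\<omega> remains.\<close>

lemma kap_norm:
  assumes "i < m" "0 < dX i"
  shows "(\<Sum>j<n. \<Sum>k<dE j i. \<Sum>l\<in>LL j. kap i j k l * cnj (kap i j k l)) = 1"
proof -
  have "(\<Sum>l\<in>LL j. kap i j k l * cnj (kap i j k l))
    = (\<Sum>y<dY j. \<Sum>a<d. kap i j k (a, y) * cnj (kap i j k (a, y)))" for j k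
    by (subst sum.swap) (simp add: sum.cartesian_product case_prod_unfold)
  then have "(\<Sum>j<n. \<Sum>k<dE j i. \<Sum>l\<in>LL j. kap i j k l * cnj (kap i j k l))
    = (\<Sum>j<n. \<Sum>k<dE j i. \<Sum>y<dY j. \<Sum>a<d. kap i j k (a, y) * cnj (kap i j k (a, y)))"
    by simp
  also have "\<dots> = (\<Sum>j<n. \<Sum>k<dE j i. \<Sum>y<dY j. \<Sum>a<d. \<Sum>h<d. \<Sum>h'<d. w a h' * cnj (w a h) * (cnj (T i j k y 0 h) * T i j k y 0 h'))"
    by (simp add: kap_def sum_distrib_left sum_distrib_right mult_ac)
  also have "\<dots> = (\<Sum>a<d. \<Sum>h<d. \<Sum>h'<d. \<Sum>j<n. \<Sum>k<dE j i. \<Sum>y<dY j. w a h' * cnj (w a h) * (cnj (T i j k y 0 h) * T i j k y 0 h'))"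
    by (rule trans[OF sum_swap_3], rule sum.cong[OF refl], rule trans[OF sum_swap_3], rule sum.cong[OF refl], rule sum_swap_3)
  also have "\<dots> = (\<Sum>a<d. \<Sum>h<d. \<Sum>h'<d. w a h' * cnj (w a h) * (if h = h' then 1 else 0))"
    using assms by (intro sum.cong refl) (simp add: sum_distrib_left[symmetric] T_tp)
  also have "\<dots> = 1" using w by (subst (asm) sum.swap) (simp add: sum_delta_mult mult.commute)
  finally show ?thesis .
qed

end
end

section \<open>Channels with a minimal dilation\<close>

lemma pair_index_eq_iff:
  fixes x h d :: nat assumes "h < d" "h' < d"
  shows "x * d + h = x' * d + h' \<longleftrightarrow> x = x' \<and> h = h'"
proof
  assume e: "x * d + h = x' * d + h'"
  have "(x * d + h) div d = x" "(x' * d + h') div d = x'" "(x * d + h) mod d = h" "(x' * d + h') mod d = h'"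
    using assms by simp_all
  then show "x = x' \<and> h = h'" using e by metis
qed simp

text \<open>Transfers the amplitude from the H-leg of \<open>K\<close> to that of \<open>S\<close>.
  With \<open>link_eq_right\<close> this puts both inversion equations in terms of the same absorbed
  operators.\<close>

lemma link_eq_left:
  "(\<Sum>y<b. \<Sum>h<d. (\<Sum>p<d. S x' (y * d + p) * w p h) * K y (x * d + h)) = link b d (\<lambda>h p. w p h) S K x' x"
  unfolding link_def
  by (rule sum.cong[OF refl], subst sum_mult_exchange[symmetric], simp add: mult.commute)

lemma link_eq_right:
  "(\<Sum>x<a. \<Sum>h<d. K y' (x * d + h) * (\<Sum>p<d. S x (y * d + p) * w p h)) = link a d w K S y' y"
  unfolding link_def by simp

locale dilated_channel =
  fixes dX dY :: "nat \<Rightarrow> nat" and m n d :: nat and dE :: "nat \<Rightarrow> nat \<Rightarrow> nat"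
    and M :: "nat \<Rightarrow> nat \<Rightarrow> complex mat \<Rightarrow> complex mat"
    and \<tau> :: "nat \<Rightarrow> nat \<Rightarrow> complex mat"
  assumes d: "d > 0"
    and M_chan: "is_channel (\<lambda>i. dX i * d) m dY n M"
    and dil: "minimal_dilation dX m dY n d dE M \<tau>"
begin

definition K :: "nat \<Rightarrow> nat \<Rightarrow> nat \<Rightarrow> nat \<Rightarrow> nat \<Rightarrow> complex" where
  "K i j k y u = \<tau> i j $$ (y * dE j i + k, u)"

abbreviation T :: "nat \<Rightarrow> nat \<Rightarrow> nat \<Rightarrow> nat \<Rightarrow> nat \<Rightarrow> nat \<Rightarrow> complex" where
  "T i j k y x h \<equiv> K i j k y (x * d + h)"

lemma \<tau>_carrier:
  assumes "i < m" "j < n" shows "\<tau> i j \<in> carrier_mat (dY j * dE j i) (dX i * d)"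
  using dil assms unfolding minimal_dilation_def by blast

lemma M_kraus: "kraus_family (\<lambda>i. dX i * d) m dY n (\<lambda>i j. {..<dE j i}) K M"
  unfolding kraus_family_def
proof (intro allI impI ballI)
  fix i j and R :: "complex mat" assume ij: "i < m" "j < n" and R: "R \<in> carrier_mat (dX i * d) (dX i * d)"
  note \<tau> = \<tau>_carrier[OF ij]
  have e: "(\<tau> i j * R * dag (\<tau> i j)) $$ (r, s) = (\<Sum>u<dX i * d. \<Sum>v<dX i * d. \<tau> i j $$ (r, u) * R $$ (u, v) * cnj (\<tau> i j $$ (s, v)))"
    if "r < dY j * dE j i" "s < dY j * dE j i" for r s
  proof -
    have "(\<tau> i j * R * dag (\<tau> i j)) $$ (r, s)
      = (\<Sum>v<dX i * d. (\<Sum>u<dX i * d. \<tau> i j $$ (r, u) * R $$ (u, v)) * cnj (\<tau> i j $$ (s, v)))"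
      using \<tau> R that by (simp add: scalar_prod_def dag_def lessThan_atLeast0)
    also have "\<dots> = (\<Sum>v<dX i * d. \<Sum>u<dX i * d. \<tau> i j $$ (r, u) * R $$ (u, v) * cnj (\<tau> i j $$ (s, v)))"
      by (simp only: sum_distrib_right)
    also have "\<dots> = (\<Sum>u<dX i * d. \<Sum>v<dX i * d. \<tau> i j $$ (r, u) * R $$ (u, v) * cnj (\<tau> i j $$ (s, v)))"
      by (rule sum.swap)
    finally show ?thesis .
  qed
  have "M i j R = ptrace2 (dY j) (dE j i) (\<tau> i j * R * dag (\<tau> i j))"
    using dil ij R unfolding minimal_dilation_def by blast
  also have "\<dots> = mat (dY j) (dY j) (\<lambda>(r, s). \<Sum>k<dE j i. \<Sum>u<dX i * d. \<Sum>v<dX i * d.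
      K i j k r u * R $$ (u, v) * cnj (K i j k s v))"
    unfolding ptrace2_def K_def by (intro cong_mat) (auto simp: e index_less_mult intro!: sum.cong)
  finally show "M i j R = mat (dY j) (dY j) (\<lambda>(r, s). \<Sum>k<dE j i. \<Sum>u<dX i * d. \<Sum>v<dX i * d.
      K i j k r u * R $$ (u, v) * cnj (K i j k s v))" .
qed

sublocale tp_kraus dX dY m n d dE T
proof
  fix i x x' h h' assume "i < m" "x < dX i" "x' < dX i" "h < d" "h' < d"
  then show "(\<Sum>j<n. \<Sum>k<dE j i. \<Sum>y<dY j. cnj (T i j k y x h) * T i j k y x' h') = (if x = x' \<and> h = h' then 1 else 0)"
    using kraus_tp_of_channel[OF M_kraus M_chan] unfolding kraus_tp_def
    by (simp add: index_less_mult pair_index_eq_iff)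
next
  fix i j and c :: "nat \<Rightarrow> complex"
  assume ij: "i < m" "j < n"
    and z: "\<And>y x h. y < dY j \<Longrightarrow> x < dX i \<Longrightarrow> h < d \<Longrightarrow> (\<Sum>k<dE j i. c k * T i j k y x h) = 0"
  have "(\<Sum>k<dE j i. c k * \<tau> i j $$ (y * dE j i + k, u)) = 0" if "y < dY j" "u < dX i * d" for y u
    using z[of y "u div d" "u mod d"] that d by (simp add: K_def less_mult_imp_div_less)
  then show "\<forall>k<dE j i. c k = 0"
    using dil ij unfolding minimal_dilation_def by blast
qed

text \<open>Stated for any pure state with an invertible amplitude matrix \<open>w\<close>, so that
  it applies to W_\<omega> and to \<Phi>_H alike.\<close>

lemma ent_invertible_imp_biunitary:
  fixes w wi :: "nat \<Rightarrow> nat \<Rightarrow> complex"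
  assumes W: "W \<in> carrier_mat (d * d) (d * d)"
    and W_index: "\<And>h p h' p'. h < d \<Longrightarrow> p < d \<Longrightarrow> h' < d \<Longrightarrow> p' < d \<Longrightarrow>
      W $$ (h * d + p, h' * d + p') = w p h * cnj (w p' h')"
    and wi: "\<And>a b. a < d \<Longrightarrow> b < d \<Longrightarrow> (\<Sum>c<d. w a c * wi c b) = (if a = b then 1 else 0)"
      "\<And>a b. a < d \<Longrightarrow> b < d \<Longrightarrow> (\<Sum>c<d. wi a c * w c b) = (if a = b then 1 else 0)"
    and inv: "ent_invertible dX m dY n d M W"
  shows "(\<exists>P. biunitary P) \<and> (\<exists>g. \<forall>i<m. \<forall>j<n. \<forall>k<dE j i. \<forall>y<dY j. \<forall>x<dX i. \<forall>h<d.
    (\<Sum>h'<d. (\<Sum>a<d. cnj (w a h) * w a h') * T i j k y x h') = (\<Sum>k'<dE j i. g i j k k' * T i j k' y x h))"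
proof -
  obtain N where N: "is_channel (\<lambda>j. dY j * d) n dX m N"
    and NM: "\<And>\<rho> i. in_sum dX m \<rho> \<Longrightarrow> i < m \<Longrightarrow> apply_map N n dX
              (apply_map_id M (\<lambda>i'. dX i' * d) m dY d (\<lambda>i'. kron (\<rho> i') W)) i = \<rho> i"
    and MN: "\<And>\<sigma> j. in_sum dY n \<sigma> \<Longrightarrow> j < n \<Longrightarrow> apply_map M m dY
              (apply_map_id N (\<lambda>j'. dY j' * d) n dX d (\<lambda>j'. kron (\<sigma> j') (swapW d W))) j = \<sigma> j"
    using inv unfolding ent_invertible_def by blast
  define L where "L j i = {..<dX i * (dY j * d)}" for j i
  obtain S where S: "kraus_family (\<lambda>j. dY j * d) n dX m L S N"
    using kraus_family_exists[OF N] unfolding L_def by blast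
  have S_tp: "kraus_tp (\<lambda>j. dY j * d) n dX m L S" by (rule kraus_tp_of_channel[OF S N])
  have W': "swapW d W \<in> carrier_mat (d * d) (d * d)" by (simp add: swapW_def)
  have W'_index: "swapW d W $$ (h * d + p, h' * d + p') = w h p * cnj (w h' p')"
    if "h < d" "p < d" "h' < d" "p' < d" for h p h' p'
    using that by (simp add: swapW_def index_less_mult W_index)
  \<comment> \<open>Absorbing \<open>w\<close> changes the trace condition of \<open>S\<close> from
    1 to 1 \<otimes> Q with Q = w^* w; its inverse \<open>Qi\<close> is wi wi^*. The scalars
    \<open>\<kappa>\<close> and \<open>\<mu>\<close> are the entries at (0,0) that
    \<open>scalar_of_composite_id\<close> provides.\<close>
  define S' where "S' j i l x y h = (\<Sum>p<d. S j i l x (y * d + p) * w p h)" for j i l x y h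
  define \<kappa> where "\<kappa> i j k l = link (dY j) d (\<lambda>h p. w p h) (S j i l) (K i j k) 0 0" for i j k l
  define \<mu> where "\<mu> i j k l = link (dX i) d w (K i j k) (S j i l) 0 0" for i j k l
  define Q where "Q h h' = (\<Sum>a<d. cnj (w a h) * w a h')" for h h'
  define Qi where "Qi h h' = (\<Sum>a<d. wi h a * cnj (wi h' a))" for h h'
  interpret linked_kraus dX dY m n d dE T L S' \<kappa> \<mu> Q Qi
  proof
    fix i i' j k l x x'
    assume "i < m" "i' < m" "j < n" "k < dE j i" "l \<in> L j i'" "x < dX i" "x' < dX i'"
    then show "(\<Sum>y<dY j. \<Sum>h<d. S' j i' l x' y h * T i j k y x h) = (if i = i' \<and> x = x' then \<kappa> i j k l else 0)"
      using scalar_of_composite_id[OF d M_kraus S W, of "\<lambda>h p. w p h" i' i j k l x' x] NM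
      by (auto simp: link_eq_left S'_def \<kappa>_def W_index L_def)
  next
    fix i j j' k l y y'
    assume "i < m" "j < n" "j' < n" "k < dE j' i" "l \<in> L j i" "y < dY j" "y' < dY j'"
    then show "(\<Sum>x<dX i. \<Sum>h<d. T i j' k y' x h * S' j i l x y h) = (if j = j' \<and> y = y' then \<mu> i j k l else 0)"
      using scalar_of_composite_id[OF d S M_kraus W', of w j' j i l k y' y] MN
      by (auto simp: link_eq_right S'_def \<mu>_def W'_index L_def)
  next
    fix j y y' h h' assume j: "j < n" and y: "y < dY j" "y' < dY j" and h: "h < d" "h' < d"
    have "(\<Sum>i<m. \<Sum>l\<in>L j i. \<Sum>x<dX i. cnj (S' j i l x y h) * S' j i l x y' h')
      = (\<Sum>i<m. \<Sum>l\<in>L j i. \<Sum>x<dX i. \<Sum>p<d. \<Sum>p'<d. cnj (w p h) * w p' h' * (cnj (S j i l x (y * d + p)) * S j i l x (y' * d + p')))"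
      unfolding S'_def cnj_sum sum_product by (intro sum.cong refl) simp
    also have "\<dots> = (\<Sum>p<d. \<Sum>p'<d. \<Sum>i<m. \<Sum>l\<in>L j i. \<Sum>x<dX i. cnj (w p h) * w p' h' * (cnj (S j i l x (y * d + p)) * S j i l x (y' * d + p')))"
      by (rule trans[OF sum_swap_3], rule sum.cong[OF refl], rule sum_swap_3)
    also have "\<dots> = (\<Sum>p<d. \<Sum>p'<d. cnj (w p h) * w p' h' * (if y = y' \<and> p = p' then 1 else 0))"
      using S_tp j y unfolding kraus_tp_def sum_distrib_left[symmetric]
      by (intro sum.cong refl) (simp add: index_less_mult pair_index_eq_iff)
    also have "\<dots> = (if y = y' then Q h h' else 0)"
      by (auto simp: Q_def sum_delta_mult)
    finally show "(\<Sum>i<m. \<Sum>l\<in>L j i. \<Sum>x<dX i. cnj (S' j i l x y h) * S' j i l x y' h') = (if y = y' then Q h h' else 0)" .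
  next
    fix h h' assume h: "h < d" "h' < d"
    have c1: "(\<Sum>c<d. cnj (wi c a) * cnj (w b c)) = (if b = a then 1 else 0)" if "a < d" "b < d" for a b
    proof -
      have "(\<Sum>c<d. cnj (wi c a) * cnj (w b c)) = cnj (\<Sum>c<d. w b c * wi c a)" by (simp add: mult.commute)
      then show ?thesis using wi(1)[OF that(2,1)] by simp
    qed
    have "(\<Sum>a<d. Qi h a * Q a h') = (\<Sum>a<d. Qi h a * (\<Sum>b<d. cnj (w b a) * w b h'))" by (simp only: Q_def)
    also have "\<dots> = (\<Sum>b<d. (\<Sum>a<d. Qi h a * cnj (w b a)) * w b h')" by (rule sum_mult_exchange)
    also have "\<dots> = (\<Sum>b<d. wi h b * w b h')"
    proof (intro sum.cong refl arg_cong2[of _ _ _ _ "(*)"])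
      fix b assume b: "b \<in> {..<d}"
      have "(\<Sum>a<d. Qi h a * cnj (w b a)) = (\<Sum>c<d. wi h c * (\<Sum>a<d. cnj (wi a c) * cnj (w b a)))"
        unfolding Qi_def by (rule sum_mult_exchange[symmetric])
      also have "\<dots> = wi h b" using b by (simp add: c1 sum_delta_mult)
      finally show "(\<Sum>a<d. Qi h a * cnj (w b a)) = wi h b" .
    qed
    finally show "(\<Sum>a<d. Qi h a * Q a h') = (if h = h' then 1 else 0)" using wi(2)[OF h] by simp
  qed
  show ?thesis
  proof
    show "\<exists>P. biunitary P" by (rule biunitary_ex)
    show "\<exists>g. \<forall>i<m. \<forall>j<n. \<forall>k<dE j i. \<forall>y<dY j. \<forall>x<dX i. \<forall>h<d.
      (\<Sum>h'<d. (\<Sum>a<d. cnj (w a h) * w a h') * T i j k y x h') = (\<Sum>k'<dE j i. g i j k k' * T i j k' y x h)"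
      using intertwiner unfolding Q_def
      by (intro exI[of _ "\<lambda>i j k k'. \<Sum>l\<in>L j i. \<kappa> i j k l * cnj (\<mu> i j k' l)"]) simp
  qed
qed

lemma biunitary_imp_ent_invertible:
  fixes w wi :: "nat \<Rightarrow> nat \<Rightarrow> complex"
  assumes W: "W \<in> carrier_mat (d * d) (d * d)"
    and W_index: "\<And>h p h' p'. h < d \<Longrightarrow> p < d \<Longrightarrow> h' < d \<Longrightarrow> p' < d \<Longrightarrow>
      W $$ (h * d + p, h' * d + p') = w p h * cnj (w p' h')"
    and wi: "\<And>a b. a < d \<Longrightarrow> b < d \<Longrightarrow> (\<Sum>c<d. w a c * wi c b) = (if a = b then 1 else 0)"
      "\<And>a b. a < d \<Longrightarrow> b < d \<Longrightarrow> (\<Sum>c<d. wi a c * w c b) = (if a = b then 1 else 0)"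
    and norm: "(\<Sum>h<d. \<Sum>a<d. cnj (w a h) * w a h) = 1"
    and P: "biunitary P"
    and g: "\<And>i j k y x h. i < m \<Longrightarrow> j < n \<Longrightarrow> k < dE j i \<Longrightarrow> y < dY j \<Longrightarrow> x < dX i \<Longrightarrow> h < d \<Longrightarrow>
      (\<Sum>h'<d. (\<Sum>a<d. cnj (w a h) * w a h') * T i j k y x h') = (\<Sum>k'<dE j i. g i j k k' * T i j k' y x h)"
  shows "ent_invertible dX m dY n d M W"
proof -
  \<comment> \<open>The Kraus operators of the inverse carry the pair index (a,y) of
    \<open>kap\<close>.\<close>
  define L where "L j i = {..<d} \<times> {..<dY j}" for j i :: nat
  define R where "R = inv_kraus P w"
  \<comment> \<open>Multiplying the H-leg by the inverse of \<open>w\<close> undoes the absorption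
    and turns the trace condition 1 \<otimes> w^* w back into the identity.\<close>
  define S where "S j i l x z = (\<Sum>h<d. R j i l x (z div d) h * wi h (z mod d))" for j i l x z
  define N where "N j i A = mat (dX i) (dX i) (\<lambda>(x, x'). \<Sum>l\<in>L j i. \<Sum>u<dY j * d. \<Sum>v<dY j * d.
    S j i l x u * A $$ (u, v) * cnj (S j i l x' v))" for j i A
  have N_kraus: "kraus_family (\<lambda>j. dY j * d) n dX m L S N"
    by (simp add: kraus_family_def N_def)
  have S_w: "(\<Sum>p<d. S j i l x (y * d + p) * w p h) = R j i l x y h" if h: "h < d" for j i l x y h
  proof -
    have "(\<Sum>p<d. S j i l x (y * d + p) * w p h) = (\<Sum>p<d. (\<Sum>h'<d. R j i l x y h' * wi h' p) * w p h)"
      by (simp add: S_def)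
    also have "\<dots> = (\<Sum>h'<d. R j i l x y h' * (\<Sum>p<d. wi h' p * w p h))"
      by (rule sum_mult_exchange[symmetric])
    also have "\<dots> = R j i l x y h" using h by (simp add: wi sum_delta_mult)
    finally show ?thesis .
  qed
  have S_tp: "kraus_tp (\<lambda>j. dY j * d) n dX m L S"
    unfolding kraus_tp_def
  proof (intro allI impI)
    fix j z z' assume j: "j < n" and z: "z < dY j * d" "z' < dY j * d"
    define y p y' p' where "y = z div d" "p = z mod d" "y' = z' div d" "p' = z' mod d"
    have z_eq: "z = y * d + p" "z' = y' * d + p'" by (simp_all add: y_p_y'_p'_def)
    have r: "y < dY j" "y' < dY j" "p < d" "p' < d"
      using z d by (simp_all add: y_p_y'_p'_def less_mult_imp_div_less)
    have "(\<Sum>i<m. \<Sum>l\<in>L j i. \<Sum>x<dX i. cnj (S j i l x z) * S j i l x z')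
      = (\<Sum>i<m. \<Sum>l\<in>L j i. \<Sum>x<dX i. \<Sum>h<d. \<Sum>h'<d. cnj (wi h p) * wi h' p' * (cnj (R j i l x y h) * R j i l x y' h'))"
      unfolding S_def y_p_y'_p'_def cnj_sum sum_product by (intro sum.cong refl) simp
    also have "\<dots> = (\<Sum>h<d. \<Sum>h'<d. \<Sum>i<m. \<Sum>l\<in>L j i. \<Sum>x<dX i. cnj (wi h p) * wi h' p' * (cnj (R j i l x y h) * R j i l x y' h'))"
      by (rule trans[OF sum_swap_3], rule sum.cong[OF refl], rule sum_swap_3)
    also have "\<dots> = (\<Sum>h<d. \<Sum>h'<d. cnj (wi h p) * wi h' p' * (if y = y' then \<Sum>a<d. cnj (w a h) * w a h' else 0))"
      using j r unfolding sum_distrib_left[symmetric] R_def L_def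
      by (intro sum.cong refl) (simp add: inv_kraus_tp[OF P g norm])
    also have "\<dots> = (if y = y' then \<Sum>h<d. cnj (wi h p) * (\<Sum>h'<d. (\<Sum>a<d. cnj (w a h) * w a h') * wi h' p') else 0)"
      by (simp add: sum_distrib_left mult_ac)
    also have "(\<Sum>h<d. cnj (wi h p) * (\<Sum>h'<d. (\<Sum>a<d. cnj (w a h) * w a h') * wi h' p'))
      = (\<Sum>h<d. cnj (wi h p) * (\<Sum>a<d. cnj (w a h) * (\<Sum>h'<d. w a h' * wi h' p')))"
      by (rule sum.cong[OF refl]) (simp only: sum_mult_exchange)
    also have "\<dots> = (\<Sum>h<d. cnj (wi h p) * cnj (w p' h))"
      using r by (simp add: wi sum_delta_mult)
    also have "\<dots> = cnj (\<Sum>h<d. w p' h * wi h p)" by (simp add: mult.commute)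
    also have "\<dots> = (if p = p' then 1 else 0)" using wi(1)[of p' p] r by auto
    finally show "(\<Sum>i<m. \<Sum>l\<in>L j i. \<Sum>x<dX i. cnj (S j i l x z) * S j i l x z') = (if z = z' then 1 else 0)"
      using r unfolding z_eq by (simp add: pair_index_eq_iff)
  qed
  have N: "is_channel (\<lambda>j. dY j * d) n dX m N" by (rule is_channel_of_kraus[OF N_kraus S_tp])
  have W': "swapW d W \<in> carrier_mat (d * d) (d * d)" by (simp add: swapW_def)
  have W'_index: "swapW d W $$ (h * d + p, h' * d + p') = w h p * cnj (w h' p')"
    if "h < d" "p < d" "h' < d" "p' < d" for h p h' p'
    using that by (simp add: swapW_def index_less_mult W_index)
  have S_K: "link (dY j) d (\<lambda>h p. w p h) (S j i l) (K i' j k) x u = (if i' = i \<and> u = x then kap w i j k l else 0)"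
    if "i < m" "i' < m" "j < n" "k \<in> {..<dE j i'}" "x < dX i" "u < dX i'" for i i' j k l x u
    unfolding link_eq_left[symmetric]
    using inv_kraus_T[OF P g norm, of i' i j k u x l] that by (simp add: S_w R_def)
  have K_S: "link (dX i) d w (K i j' k) (S j i l) y' y = (if j = j' \<and> y = y' then mu P w i j' k l else 0)"
    if "i < m" "j < n" "j' < n" "k \<in> {..<dE j' i}" "y < dY j" "y' < dY j'" for i j j' k l y y'
    unfolding link_eq_right[symmetric]
    using T_inv_kraus[OF P g norm, of i j j' k y y' l] that by (simp add: S_w R_def)
  have NM: "apply_map N n dX (apply_map_id M (\<lambda>i'. dX i' * d) m dY d (\<lambda>i'. kron (\<rho> i') W)) i = \<rho> i"
    if "in_sum dX m \<rho>" "i < m" for \<rho> i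
    by (rule composite_id_of_scalar[OF d M_kraus N_kraus W W_index S_K _ that])
      (simp_all add: L_def kap_norm[OF P g norm])
  have MN: "apply_map M m dY (apply_map_id N (\<lambda>j'. dY j' * d) n dX d (\<lambda>j'. kron (\<sigma> j') (swapW d W))) j = \<sigma> j"
    if "in_sum dY n \<sigma>" "j < n" for \<sigma> j
  proof (rule composite_id_of_scalar[OF d N_kraus M_kraus W' W'_index K_S _ that])
    fix j assume j: "j < n" "0 < dY j"
    have "(\<Sum>i<m. \<Sum>l\<in>L j i. \<Sum>k<dE j i. mu P w i j k l * cnj (mu P w i j k l))
      = (\<Sum>i<m. \<Sum>k<dE j i. \<Sum>l\<in>L j i. mu P w i j k l * cnj (mu P w i j k l))"
      by (rule sum.cong[OF refl]) (rule sum.swap)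
    then show "(\<Sum>i<m. \<Sum>l\<in>L j i. \<Sum>k<dE j i. mu P w i j k l * cnj (mu P w i j k l)) = 1"
      using mu_norm[OF P g norm j] by (simp add: L_def)
  qed simp_all
  show ?thesis unfolding ent_invertible_def
    using N NM MN by blast
qed

lemma intertwiner_index_iff:
  assumes ij: "i < m" "j < n" and G: "G \<in> carrier_mat (dE j i) (dE j i)" and r: "r1 \<in> carrier_mat d d"
  shows "\<tau> i j * kron (1\<^sub>m (dX i)) r1 = kron (1\<^sub>m (dY j)) G * \<tau> i j \<longleftrightarrow>
    (\<forall>k<dE j i. \<forall>y<dY j. \<forall>x<dX i. \<forall>h<d.
      (\<Sum>h'<d. T i j k y x h' * r1 $$ (h', h)) = (\<Sum>k'<dE j i. G $$ (k, k') * T i j k' y x h))"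
    (is "?A = ?B \<longleftrightarrow> ?I")
proof -
  note \<tau> = \<tau>_carrier[OF ij]
  have A: "?A $$ (y * dE j i + k, x * d + h) = (\<Sum>h'<d. T i j k y x h' * r1 $$ (h', h))"
    if "k < dE j i" "y < dY j" "x < dX i" "h < d" for k y x h
  proof -
    have "?A $$ (y * dE j i + k, x * d + h)
      = (\<Sum>x'<dX i. \<Sum>h'<d. T i j k y x' h' * ((if x' = x then 1 else 0) * r1 $$ (h', h)))"
      using that \<tau> r by (simp add: scalar_prod_def kron_def index_less_mult K_def
        lessThan_atLeast0[symmetric] sum_lessThan_mult)
    also have "\<dots> = (\<Sum>x'<dX i. if x' = x then \<Sum>h'<d. T i j k y x h' * r1 $$ (h', h) else 0)"
      by (intro sum.cong refl) auto
    finally show ?thesis using that by simp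
  qed
  have B: "?B $$ (y * dE j i + k, x * d + h) = (\<Sum>k'<dE j i. G $$ (k, k') * T i j k' y x h)"
    if "k < dE j i" "y < dY j" "x < dX i" "h < d" for k y x h
  proof -
    have "?B $$ (y * dE j i + k, x * d + h)
      = (\<Sum>y'<dY j. \<Sum>k'<dE j i. (if y = y' then 1 else 0) * G $$ (k, k') * T i j k' y' x h)"
      using that \<tau> G by (simp add: scalar_prod_def kron_def index_less_mult K_def
        lessThan_atLeast0[symmetric] sum_lessThan_mult)
    also have "\<dots> = (\<Sum>y'<dY j. if y = y' then \<Sum>k'<dE j i. G $$ (k, k') * T i j k' y x h else 0)"
      by (intro sum.cong refl) auto
    finally show ?thesis using that by simp
  qed
  show ?thesis
  proof
    assume "?A = ?B"
    then show ?I by (simp add: A[symmetric] B[symmetric])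
  next
    assume I: ?I
    show "?A = ?B"
    proof (rule eq_matI)
      fix a b assume "a < dim_row ?B" "b < dim_col ?B"
      then have ab: "a < dY j * dE j i" "b < dX i * d" using \<tau> G by (auto simp: kron_def)
      \<comment> \<open>Since \<open>a < dY j * dE j i\<close>, the factor \<open>dE j i\<close> is
        positive, so \<open>a mod dE j i\<close> is a valid index.\<close>
      then have e: "0 < dE j i" by (cases "dE j i") auto
      define y k x h where "y = a div dE j i" "k = a mod dE j i" "x = b div d" "h = b mod d"
      have ab_eq: "a = y * dE j i + k" "b = x * d + h" by (simp_all add: y_k_x_h_def)
      have r: "k < dE j i" "y < dY j" "x < dX i" "h < d"
        using ab d e by (simp_all add: y_k_x_h_def less_mult_imp_div_less)
      show "?A $$ (a, b) = ?B $$ (a, b)"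
        unfolding ab_eq A[OF r] B[OF r] using I r by blast
    qed (use \<tau> G r in \<open>auto simp: kron_def\<close>)
  qed
qed

end

theorem mainTheorem5:
  fixes dX dY :: "nat \<Rightarrow> nat" and m n d :: nat and dE :: "nat \<Rightarrow> nat \<Rightarrow> nat"
    and \<omega> :: "complex mat"
    and M :: "nat \<Rightarrow> nat \<Rightarrow> complex mat \<Rightarrow> complex mat"
    and \<tau> :: "nat \<Rightarrow> nat \<Rightarrow> complex mat"
  assumes \<omega>_dim: "\<omega> \<in> carrier_mat d d"
    and \<omega>_inv: "invertible_mat \<omega>"
    and \<omega>_norm: "mtrace (dag \<omega> * \<omega>) = 1"
    and M_chan: "is_channel (\<lambda>i. dX i * d) m dY n M"
    and dil: "minimal_dilation dX m dY n d dE M \<tau>"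
  shows "ent_invertible dX m dY n d M (W_omega d \<omega>) \<longleftrightarrow>
    (ent_invertible dX m dY n d M (Phi_max d) \<and>
     (\<exists>g :: nat \<Rightarrow> nat \<Rightarrow> complex mat. \<forall>i<m. \<forall>j<n.
        g i j \<in> carrier_mat (dE j i) (dE j i) \<and>
        \<tau> i j * kron (1\<^sub>m (dX i)) (ptrace2 d d (W_omega d \<omega>))
          = kron (1\<^sub>m (dY j)) (g i j) * \<tau> i j))"
proof -
  define w where "w p h = \<omega> $$ (p, h)" for p h
  have norm: "(\<Sum>h<d. \<Sum>a<d. cnj (w a h) * w a h) = 1"
    using \<omega>_norm \<omega>_dim by (simp add: mtrace_def dag_def scalar_prod_def w_def lessThan_atLeast0)
  have d: "d > 0" using norm by (cases d) auto
  interpret dilated_channel dX dY m n d dE M \<tau>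
    using d M_chan dil by unfold_locales
  obtain B where B: "\<omega> * B = 1\<^sub>m d" "B * \<omega> = 1\<^sub>m (dim_row B)"
    using \<omega>_inv \<omega>_dim unfolding invertible_mat_def inverts_mat_def by auto
  \<comment> \<open>\<open>B\<close> comes without dimensions; comparing the column counts in both
    equations supplies them.\<close>
  have B_dim: "B \<in> carrier_mat d d"
    using arg_cong[OF B(1), of dim_col] arg_cong[OF B(2), of dim_col] \<omega>_dim by auto
  define wi where "wi p h = B $$ (p, h)" for p h
  have wi: "(\<Sum>c<d. w a c * wi c b) = (if a = b then 1 else 0)"
    "(\<Sum>c<d. wi a c * w c b) = (if a = b then 1 else 0)" if "a < d" "b < d" for a b
    using arg_cong[OF B(1), of "\<lambda>A. A $$ (a, b)"] arg_cong[OF B(2), of "\<lambda>A. A $$ (a, b)"] that \<omega>_dim B_dim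
    by (simp_all add: scalar_prod_def w_def wi_def lessThan_atLeast0)
  have W: "W_omega d \<omega> \<in> carrier_mat (d * d) (d * d)" by (simp add: W_omega_def)
  have W_index: "W_omega d \<omega> $$ (h * d + p, h' * d + p') = w p h * cnj (w p' h')"
    if "h < d" "p < d" "h' < d" "p' < d" for h p h' p'
    using that by (simp add: W_omega_def index_less_mult w_def)
  define r1 where "r1 = ptrace2 d d (W_omega d \<omega>)"
  have r1: "r1 \<in> carrier_mat d d" by (simp add: r1_def ptrace2_def)
  \<comment> \<open>\<rho>_1 is the transpose of \<omega>^*\<omega>, since \<omega> acts on the
    factor that is traced out. Multiplying \<tau> by it from the right thus gives the contraction
    with \<omega>^*\<omega> used above.\<close>
  have r1_index: "r1 $$ (h', h) = (\<Sum>a<d. cnj (w a h) * w a h')" if "h < d" "h' < d" for h h'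
    using that by (simp add: r1_def ptrace2_def W_index) (simp add: mult.commute)
  have intw: "\<tau> i j * kron (1\<^sub>m (dX i)) r1 = kron (1\<^sub>m (dY j)) G * \<tau> i j \<longleftrightarrow>
    (\<forall>k<dE j i. \<forall>y<dY j. \<forall>x<dX i. \<forall>h<d.
      (\<Sum>h'<d. (\<Sum>a<d. cnj (w a h) * w a h') * T i j k y x h') = (\<Sum>k'<dE j i. G $$ (k, k') * T i j k' y x h))"
    if "i < m" "j < n" "G \<in> carrier_mat (dE j i) (dE j i)" for i j G
    unfolding intertwiner_index_iff[OF that r1] by (simp add: r1_index mult.commute)
  \<comment> \<open>The amplitude matrix of \<Phi>_H, with inverse \<open>vi\<close>. As v^* v =
    1/d, the scalar 1/d serves as intertwiner for every T.\<close>
  define v where "v p h = (if p = h then complex_of_real (1 / sqrt d) else 0)" for p h :: nat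
  define vi where "vi p h = (if p = h then complex_of_real (sqrt d) else 0)" for p h :: nat
  have sqd: "complex_of_real (sqrt d) * complex_of_real (sqrt d) = of_nat d"
    by (simp flip: of_real_mult)
  have V: "Phi_max d \<in> carrier_mat (d * d) (d * d)" by (simp add: Phi_max_def)
  have V_index: "Phi_max d $$ (h * d + p, h' * d + p') = v p h * cnj (v p' h')"
    if "h < d" "p < d" "h' < d" "p' < d" for h p h' p'
    using that by (auto simp: Phi_max_def index_less_mult v_def sqd)
  have vv: "(\<Sum>a<d. cnj (v a h) * v a h') = (if h = h' then 1 / of_nat d else 0)" if "h < d" for h h'
  proof -
    have "(\<Sum>a<d. cnj (v a h) * v a h') = (\<Sum>a<d. if a = h then cnj (v h h) * v h h' else 0)"
      by (intro sum.cong refl) (auto simp: v_def)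
    then show ?thesis using that by (auto simp: v_def sqd)
  qed
  have vi: "(\<Sum>c<d. v a c * vi c b) = (if a = b then 1 else 0)"
    "(\<Sum>c<d. vi a c * v c b) = (if a = b then 1 else 0)" if "a < d" "b < d" for a b
  proof -
    have "(\<Sum>c<d. v a c * vi c b) = (\<Sum>c<d. if c = a then v a a * vi a b else 0)"
      "(\<Sum>c<d. vi a c * v c b) = (\<Sum>c<d. if c = a then vi a a * v a b else 0)"
      by (intro sum.cong refl; auto simp: v_def vi_def)+
    then show "(\<Sum>c<d. v a c * vi c b) = (if a = b then 1 else 0)"
      "(\<Sum>c<d. vi a c * v c b) = (if a = b then 1 else 0)"
      using that d by (auto simp: v_def vi_def)
  qed
  have v_norm: "(\<Sum>h<d. \<Sum>a<d. cnj (v a h) * v a h) = 1" using d by (simp add: vv)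
  have v_int: "(\<Sum>h'<d. (\<Sum>a<d. cnj (v a h) * v a h') * T i j k y x h')
      = (\<Sum>k'<dE j i. (if k = k' then 1 / of_nat d else 0) * T i j k' y x h)"
    if "i < m" "j < n" "k < dE j i" "y < dY j" "x < dX i" "h < d" for i j k y x h
    using that by (simp add: vv if_distrib[of "\<lambda>z. z * _"] cong: if_cong)
  show ?thesis
    unfolding r1_def[symmetric]
  proof
    assume "ent_invertible dX m dY n d M (W_omega d \<omega>)"
    from ent_invertible_imp_biunitary[OF W W_index wi this] obtain P g where P: "biunitary P"
      and g: "\<forall>i<m. \<forall>j<n. \<forall>k<dE j i. \<forall>y<dY j. \<forall>x<dX i. \<forall>h<d.
        (\<Sum>h'<d. (\<Sum>a<d. cnj (w a h) * w a h') * T i j k y x h') = (\<Sum>k'<dE j i. g i j k k' * T i j k' y x h)"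
      by blast
    \<comment> \<open>Only \<open>P\<close> passes from W_\<omega> to \<Phi>_H, where it is combined
      with the scalar intertwiner; \<open>g\<close> supplies part (b).\<close>
    have "ent_invertible dX m dY n d M (Phi_max d)"
      by (rule biunitary_imp_ent_invertible[OF V V_index vi v_norm P v_int])
    moreover have "\<tau> i j * kron (1\<^sub>m (dX i)) r1
        = kron (1\<^sub>m (dY j)) (mat (dE j i) (dE j i) (\<lambda>(k, k'). g i j k k')) * \<tau> i j"
      if "i < m" "j < n" for i j
      using that g by (subst intw) simp_all
    ultimately show "ent_invertible dX m dY n d M (Phi_max d) \<and> (\<exists>g. \<forall>i<m. \<forall>j<n.
        g i j \<in> carrier_mat (dE j i) (dE j i) \<and>
        \<tau> i j * kron (1\<^sub>m (dX i)) r1 = kron (1\<^sub>m (dY j)) (g i j) * \<tau> i j)"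
      by (intro conjI exI[of _ "\<lambda>i j. mat (dE j i) (dE j i) (\<lambda>(k, k'). g i j k k')"]) auto
  next
    assume asm: "ent_invertible dX m dY n d M (Phi_max d) \<and> (\<exists>g. \<forall>i<m. \<forall>j<n.
        g i j \<in> carrier_mat (dE j i) (dE j i) \<and>
        \<tau> i j * kron (1\<^sub>m (dX i)) r1 = kron (1\<^sub>m (dY j)) (g i j) * \<tau> i j)"
    then obtain G where G: "\<And>i j. i < m \<Longrightarrow> j < n \<Longrightarrow> G i j \<in> carrier_mat (dE j i) (dE j i)"
      "\<And>i j. i < m \<Longrightarrow> j < n \<Longrightarrow> \<tau> i j * kron (1\<^sub>m (dX i)) r1 = kron (1\<^sub>m (dY j)) (G i j) * \<tau> i j"
      by blast
    \<comment> \<open>Biunitarity comes from part (a), the intertwiner from part (b).\<close>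
    obtain P where P: "biunitary P"
      using ent_invertible_imp_biunitary[OF V V_index vi] asm by blast
    have int: "(\<Sum>h'<d. (\<Sum>a<d. cnj (w a h) * w a h') * T i j k y x h') = (\<Sum>k'<dE j i. G i j $$ (k, k') * T i j k' y x h)"
      if "i < m" "j < n" "k < dE j i" "y < dY j" "x < dX i" "h < d" for i j k y x h
      using intw[OF that(1,2) G(1)[OF that(1,2)]] G(2)[OF that(1,2)] that by blast
    show "ent_invertible dX m dY n d M (W_omega d \<omega>)"
      by (rule biunitary_imp_ent_invertible[OF W W_index wi norm P int])
  qed
qed

end
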